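(* In the setting described in the context, assume the following: (C1) $u\mapsto 1/\gamma(u)$ is Lipschitz continuous on $U$ with constant $c_\gamma$; (C2) $\lim_{n\to\infty}h_n\log(u_n)=0$; (C3) there exist $y_0>1$ and $c_L>0$ such that $\sup_{y\ge y_0}\left|\frac{\log L^{v}(y)-\log L^{u}(y)}{\log y}\right|\le c_L|v-u|$ for all $u,v\in U$; (C5) $g_n(x)\to g(x)$ in probability; and that $\widetilde T_n^x(s)\to s^{-1/\gamma(x)}$ in probability for every $s>0$. Then the conditional Hill estimator satisfies $\widehat\gamma_n(x)\to\gamma(x)$ in probability.
   Context: $\{(X_j,Y_j)\}_{j\in\mathbb Z}$ is a stationary time series of real random variables with $Y_j>0$. $X_0$ has a twice continuously differentiable density $g$, and for all $i\neq j$ the pair $(X_i,X_j)$ has a joint density which is bounded. $F^u$ denotes the conditional distribution function of $Y_0$ given $X_0=u$ and $\overline F^u=1-F^u$. $U\subseteq\mathbb R$ is open and $x\in U$ is fixed with $g(x)>0$. Conditional regular variation: for all $u\in U$, $\overline F^u(y)=L^u(y)y^{-1/\gamma(u)}$ for $y>0$, where $\gamma(u)>0$ and $L^u$ is slowly varying at infinity. $K$ is a bounded probability density supported on $[-1,1]$ and $h_n>0$ is a bandwidth sequence. $k_n\le n$ is an intermediate sequence: $k_n\to\infty$, $k_n/n\to0$; $u_n=u_n^x=F^{\leftarrow,x}(1-k_n/n)$ (generalised inverse of $F^x$), so $u_n\to\infty$, and $\overline F^x(u_n)=k_n/n$. Put $g_n(x)=\frac1{nh_n}\sum_{j=1}^nK\left(\frac{x-X_j}{h_n}\right)$,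 $\widetilde V_n^x(s)=\frac{1}{nh_n\overline F^x(u_n)}\sum_{j=1}^nK\left(\frac{x-X_j}{h_n}\right)1_{\{Y_j>su_n\}}$ and $\widetilde T_n^x(s)=\widetilde V_n^x(s)/g_n(x)$ for $s>0$ (with an arbitrary convention when $g_n(x)=0$). The Nadaraya--Watson estimator of $\overline F^x$ is $\overline F_n^x(y)=\sum_{j=1}^nK\left(\frac{x-X_j}{h_n}\right)1_{\{Y_j>y\}}\Big/\sum_{j=1}^nK\left(\frac{x-X_j}{h_n}\right)$, $F_n^x=1-\overline F_n^x$, and $q_n=q_{n,k_n}^x=F_n^{\leftarrow,x}(1-k_n/n)$ (generalised inverse of $F_n^x$). The estimated conditional tail function is $\widehat T_n^x(s)=\overline F_n^x(sq_n)/\overline F^x(u_n)=\widetilde T_n^x(sq_n/u_n)$, and the conditional Hill estimator is $$\widehat\gamma_n(x)=\int_1^\infty\frac{\widehat T_n^x(s)}{s}\,ds=\frac n{k_n}\,\frac{\sum_{j=1}^nK\left(\frac{x-X_j}{h_n}\right)\log_+(Y_j/q_n)}{\sum_{j=1}^nK\left(\frac{x-X_j}{h_n}\right)}.$$ *)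

theory Defs
  imports "HOL-Probability.Probability"
begin

(* Random variables are required to be measurable: the measure of a non-measurable set is 0,
   so without this clause the limit below could hold for no good reason. *)
definition conv_in_prob :: "'a measure \<Rightarrow> (nat \<Rightarrow> 'a \<Rightarrow> real) \<Rightarrow> real \<Rightarrow> bool" where
  "conv_in_prob M Z c \<longleftrightarrow>
     (\<forall>n. Z n \<in> borel_measurable M) \<and>
     (\<forall>\<epsilon>>0. (\<lambda>n. measure M {\<omega> \<in> space M. \<bar>Z n \<omega> - c\<bar> > \<epsilon>}) \<longlonglongrightarrow> 0)"

(* Strict stationarity: shift invariance of all finite-dimensional distributions. *)
definition stationary :: "'a measure \<Rightarrow> (int \<Rightarrow> 'a \<Rightarrow> 'b::topological_space) \<Rightarrow> bool" where
  "stationary M Z \<longleftrightarrow>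
     (\<forall>j. Z j \<in> borel_measurable M) \<and>
     (\<forall>J m. finite J \<longrightarrow>
        distr M (\<Pi>\<^sub>M j\<in>J. borel) (\<lambda>\<omega>. \<lambda>j\<in>J. Z (j + m) \<omega>) =
        distr M (\<Pi>\<^sub>M j\<in>J. borel) (\<lambda>\<omega>. \<lambda>j\<in>J. Z j \<omega>))"

definition C2_on_reals :: "(real \<Rightarrow> real) \<Rightarrow> bool" where
  "C2_on_reals g \<longleftrightarrow>
     (\<exists>g' g''. (\<forall>u. (g has_real_derivative g' u) (at u)) \<and>
               (\<forall>u. (g' has_real_derivative g'' u) (at u)) \<and> continuous_on UNIV g'')"

(* kappa u is a version of the law of Y given X = u, chosen for every u and measurable in u. *)
definition regular_cond_dist ::
  "'a measure \<Rightarrow> ('a \<Rightarrow> real) \<Rightarrow> ('a \<Rightarrow> real) \<Rightarrow> (real \<Rightarrow> real measure) \<Rightarrow> bool" where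
  "regular_cond_dist M X Y \<kappa> \<longleftrightarrow>
     \<kappa> \<in> measurable borel (prob_algebra borel) \<and>
     (\<forall>A\<in>sets borel. \<forall>B\<in>sets borel.
        emeasure M {\<omega> \<in> space M. X \<omega> \<in> A \<and> Y \<omega> \<in> B} =
        (\<integral>\<^sup>+u\<in>A. emeasure (\<kappa> u) B \<partial>distr M borel X))"

definition slowly_varying :: "(real \<Rightarrow> real) \<Rightarrow> bool" where
  "slowly_varying L \<longleftrightarrow>
     (\<exists>a. (\<forall>y\<ge>a. 0 < L y) \<and> set_borel_measurable borel {a..} L) \<and>
     (\<forall>t>0. ((\<lambda>y. L (t * y) / L y) \<longlongrightarrow> 1) at_top)"

(* The infimum is the true one whenever the set is nonempty and bounded below, as it is for a
   distribution function F and 0 < p < 1. *)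
definition gen_inverse :: "(real \<Rightarrow> real) \<Rightarrow> real \<Rightarrow> real" where
  "gen_inverse F p = Inf {y. p \<le> F y}"

definition cond_sf :: "(real \<Rightarrow> real measure) \<Rightarrow> real \<Rightarrow> real \<Rightarrow> real" where
  "cond_sf \<kappa> u y = 1 - cdf (\<kappa> u) y"

definition threshold ::
  "(real \<Rightarrow> real measure) \<Rightarrow> (nat \<Rightarrow> real) \<Rightarrow> real \<Rightarrow> nat \<Rightarrow> real" where
  "threshold \<kappa> k x n = gen_inverse (cdf (\<kappa> x)) (1 - k n / real n)"

definition kernel_density ::
  "(real \<Rightarrow> real) \<Rightarrow> (nat \<Rightarrow> real) \<Rightarrow> (int \<Rightarrow> 'a \<Rightarrow> real) \<Rightarrow> real \<Rightarrow> nat \<Rightarrow> 'a \<Rightarrow> real" where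
  "kernel_density K h X x n \<omega> =
     1 / (real n * h n) * (\<Sum>j=1..n. K ((x - X (int j) \<omega>) / h n))"

definition tail_V ::
  "(real \<Rightarrow> real measure) \<Rightarrow> (real \<Rightarrow> real) \<Rightarrow> (nat \<Rightarrow> real) \<Rightarrow> (nat \<Rightarrow> real) \<Rightarrow>
   (int \<Rightarrow> 'a \<Rightarrow> real) \<Rightarrow> (int \<Rightarrow> 'a \<Rightarrow> real) \<Rightarrow> real \<Rightarrow> real \<Rightarrow> nat \<Rightarrow> 'a \<Rightarrow> real" where
  "tail_V \<kappa> K h k X Y x s n \<omega> =
     1 / (real n * h n * cond_sf \<kappa> x (threshold \<kappa> k x n)) *
     (\<Sum>j=1..n. K ((x - X (int j) \<omega>) / h n) *
        indicator {y. y > s * threshold \<kappa> k x n} (Y (int j) \<omega>))"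

definition tail_T ::
  "(real \<Rightarrow> real measure) \<Rightarrow> (real \<Rightarrow> real) \<Rightarrow> (nat \<Rightarrow> real) \<Rightarrow> (nat \<Rightarrow> real) \<Rightarrow>
   (int \<Rightarrow> 'a \<Rightarrow> real) \<Rightarrow> (int \<Rightarrow> 'a \<Rightarrow> real) \<Rightarrow> real \<Rightarrow> real \<Rightarrow> nat \<Rightarrow> 'a \<Rightarrow> real" where
  "tail_T \<kappa> K h k X Y x s n \<omega> = tail_V \<kappa> K h k X Y x s n \<omega> / kernel_density K h X x n \<omega>"

definition nw_sf ::
  "(real \<Rightarrow> real) \<Rightarrow> (nat \<Rightarrow> real) \<Rightarrow> (int \<Rightarrow> 'a \<Rightarrow> real) \<Rightarrow> (int \<Rightarrow> 'a \<Rightarrow> real) \<Rightarrow>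
   real \<Rightarrow> nat \<Rightarrow> 'a \<Rightarrow> real \<Rightarrow> real" where
  "nw_sf K h X Y x n \<omega> y =
     (\<Sum>j=1..n. K ((x - X (int j) \<omega>) / h n) * indicator {z. z > y} (Y (int j) \<omega>)) /
     (\<Sum>j=1..n. K ((x - X (int j) \<omega>) / h n))"

definition nw_quantile ::
  "(real \<Rightarrow> real) \<Rightarrow> (nat \<Rightarrow> real) \<Rightarrow> (nat \<Rightarrow> real) \<Rightarrow> (int \<Rightarrow> 'a \<Rightarrow> real) \<Rightarrow>
   (int \<Rightarrow> 'a \<Rightarrow> real) \<Rightarrow> real \<Rightarrow> nat \<Rightarrow> 'a \<Rightarrow> real" where
  "nw_quantile K h k X Y x n \<omega> =
     gen_inverse (\<lambda>y. 1 - nw_sf K h X Y x n \<omega> y) (1 - k n / real n)"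

definition est_tail ::
  "(real \<Rightarrow> real measure) \<Rightarrow> (real \<Rightarrow> real) \<Rightarrow> (nat \<Rightarrow> real) \<Rightarrow> (nat \<Rightarrow> real) \<Rightarrow>
   (int \<Rightarrow> 'a \<Rightarrow> real) \<Rightarrow> (int \<Rightarrow> 'a \<Rightarrow> real) \<Rightarrow> real \<Rightarrow> real \<Rightarrow> nat \<Rightarrow> 'a \<Rightarrow> real" where
  "est_tail \<kappa> K h k X Y x s n \<omega> =
     nw_sf K h X Y x n \<omega> (s * nw_quantile K h k X Y x n \<omega>) /
     cond_sf \<kappa> x (threshold \<kappa> k x n)"

definition cond_hill ::
  "(real \<Rightarrow> real measure) \<Rightarrow> (real \<Rightarrow> real) \<Rightarrow> (nat \<Rightarrow> real) \<Rightarrow> (nat \<Rightarrow> real) \<Rightarrow>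
   (int \<Rightarrow> 'a \<Rightarrow> real) \<Rightarrow> (int \<Rightarrow> 'a \<Rightarrow> real) \<Rightarrow> real \<Rightarrow> nat \<Rightarrow> 'a \<Rightarrow> real" where
  "cond_hill \<kappa> K h k X Y x n \<omega> =
     (LBINT s:{1..}. est_tail \<kappa> K h k X Y x s n \<omega> / s)"

lemma est_tail_eq_tail_T:
  assumes "n > 0" "h n > 0" "threshold \<kappa> k x n \<noteq> 0"
  shows "est_tail \<kappa> K h k X Y x s n \<omega> =
     tail_T \<kappa> K h k X Y x (s * nw_quantile K h k X Y x n \<omega> / threshold \<kappa> k x n) n \<omega>"
  using assms
  by (simp add: est_tail_def tail_T_def tail_V_def nw_sf_def kernel_density_def)

lemma LBINT_indicator_over:
  fixes q y :: real
  assumes "q > 0" "y > 0"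
  shows "set_integrable lborel {1..} (\<lambda>s. indicator {z. z > s * q} y / s)"
    and "(LBINT s:{1..}. indicator {z. z > s * q} y / s) = max 0 (ln (y / q))"
proof -
  define b where "b = max 1 (y / q)"
  have b: "b \<ge> 1" by (simp add: b_def)
  have ind: "indicator {1..} s *\<^sub>R (indicator {z. z > s * q} y / s) =
      indicator {1..b} s *\<^sub>R (1 / s :: real)" if "s \<notin> {b}" for s
  proof (cases "s \<ge> 1")
    case True
    then have "y / q > s \<longleftrightarrow> s \<in> {1..b}"
      using that by (auto simp: b_def max_def split: if_splits)
    then show ?thesis
      using True assms by (auto simp: indicator_def pos_less_divide_eq)
  qed simp
  have ae: "AE s in lborel. indicator {1..} s *\<^sub>R (indicator {z. z > s * q} y / s) =
      indicator {1..b} s *\<^sub>R (1 / s :: real)"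
    by (rule AE_I'[of "{b}"]) (use ind in \<open>auto intro!: null_setsI\<close>)
  have meas: "(\<lambda>s. indicator {1..} s *\<^sub>R (indicator {z. z > s * q} y / s :: real)) \<in> borel_measurable lborel"
    by (simp add: indicator_def)
  have int: "set_integrable lborel {1..b} (\<lambda>s. 1 / s :: real)"
    by (rule borel_integrable_atLeastAtMost') (auto intro!: continuous_intros)
  show "set_integrable lborel {1..} (\<lambda>s. indicator {z. z > s * q} y / s)"
    using int meas ae unfolding set_integrable_def
    by (subst integrable_cong_AE) auto
  have "(LBINT s:{1..}. indicator {z. z > s * q} y / s) =
      (\<integral>s. indicator {1..b} s *\<^sub>R (1 / s) \<partial>lborel)"
    unfolding set_lebesgue_integral_def by (rule integral_cong_AE) (use meas ae in auto)
  also have "\<dots> = ln b - ln 1"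
    by (rule integral_FTC_atLeastAtMost[OF b])
       (auto intro!: continuous_intros DERIV_subset[OF DERIV_ln_divide]
             simp flip: has_real_derivative_iff_has_vector_derivative)
  also have "\<dots> = max 0 (ln (y / q))"
    using assms by (auto simp: b_def max_def ln_ge_zero_iff)
  finally show "(LBINT s:{1..}. indicator {z. z > s * q} y / s) = max 0 (ln (y / q))" .
qed

lemma cond_hill_eq_log:
  fixes K :: "real \<Rightarrow> real"
  assumes sf: "cond_sf \<kappa> x (threshold \<kappa> k x n) = k n / real n"
    and q: "nw_quantile K h k X Y x n \<omega> > 0"
    and Y: "\<And>j. Y j \<omega> > 0"
  shows "cond_hill \<kappa> K h k X Y x n \<omega> =
     real n / k n *
     ((\<Sum>j=1..n. K ((x - X (int j) \<omega>) / h n) *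
         max 0 (ln (Y (int j) \<omega> / nw_quantile K h k X Y x n \<omega>))) /
      (\<Sum>j=1..n. K ((x - X (int j) \<omega>) / h n)))"
proof -
  define q where "q = nw_quantile K h k X Y x n \<omega>"
  define w where "w j = K ((x - X (int j) \<omega>) / h n)" for j :: nat
  define W where "W = (\<Sum>j=1..n. w j)"
  have I: "set_integrable lborel {1..} (\<lambda>s. indicator {z. z > s * q} (Y (int j) \<omega>) / s)"
    "(LBINT s:{1..}. indicator {z. z > s * q} (Y (int j) \<omega>) / s) = max 0 (ln (Y (int j) \<omega> / q))"
    for j using LBINT_indicator_over[of q] q Y by (auto simp: q_def)
  have "est_tail \<kappa> K h k X Y x s n \<omega> / s =
      real n / k n / W * (\<Sum>j=1..n. w j * (indicator {z. z > s * q} (Y (int j) \<omega>) / s))" for s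
    by (simp add: est_tail_def nw_sf_def sf w_def W_def q_def sum_divide_distrib[symmetric] mult_ac)
  then have "cond_hill \<kappa> K h k X Y x n \<omega> = real n / k n / W *
      (LBINT s:{1..}. (\<Sum>j=1..n. w j * (indicator {z. z > s * q} (Y (int j) \<omega>) / s)))"
    by (simp add: cond_hill_def)
  also have "(LBINT s:{1..}. (\<Sum>j=1..n. w j * (indicator {z. z > s * q} (Y (int j) \<omega>) / s))) =
      (\<Sum>j=1..n. LBINT s:{1..}. w j * (indicator {z. z > s * q} (Y (int j) \<omega>) / s))"
    unfolding set_lebesgue_integral_def scaleR_sum_right
    by (rule Bochner_Integration.integral_sum)
       (rule set_integrable_mult_right[OF I(1), unfolded set_integrable_def])
  also have "\<dots> = (\<Sum>j=1..n. w j * max 0 (ln (Y (int j) \<omega> / q)))"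
    by (subst set_integral_mult_right) (simp add: I(2))
  finally show ?thesis by (simp add: w_def W_def q_def)
qed

end

theory Submission
  imports Defs "HOL-Real_Asymp.Real_Asymp"
begin

text \<open>Why the conditional Hill estimator is consistent. Write \<open>u\<close> for the threshold, \<open>q\<close> for the empirical
quantile and \<open>\<alpha> = 1 / \<gamma> x\<close>. The estimator integrates the empirical tail \<open>T s\<close> against \<open>ds / s\<close>
over \<open>s \<ge> q / u\<close>. Since \<open>T s\<close> converges to \<open>s powr - \<alpha>\<close> and \<open>q / u\<close> to \<open>1\<close>, the limit should be the
integral of \<open>s powr - \<alpha> / s\<close> over \<open>s \<ge> 1\<close>, which is \<open>1 / \<alpha> = \<gamma> x\<close>. Pointwise convergence does
not suffice for this: mass could escape to infinity.

Monotonicity reduces the bounded part of the range to finitely many values of \<open>T\<close>. On a geometric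
grid with ratio \<open>r > 1\<close> the logarithm lies between two multiples of counting functions, so the
estimator lies between \<open>ln r\<close> times sums of values of \<open>T\<close> at grid points
(\<open>cond_hill_grid_bounds\<close>); the quantile is trapped between \<open>u / r\<close> and \<open>r * u\<close> as soon as
\<open>T (1 / r) > 1 \<ge> T r\<close>. The limits of these sums are geometric series, and they approach
\<open>1 / \<alpha>\<close> as \<open>r\<close> tends to \<open>1\<close> (\<open>exists_grid_ratio\<close>).

What remains above a large multiple \<open>b * u\<close> is small in mean, uniformly in \<open>n\<close>
(\<open>expected_log_excess_le\<close>). Indeed, conditional tails at points within the bandwidth of \<open>x\<close>
satisfy \<open>cond_sf \<kappa> v (s * u) \<le> C * s powr - \<delta> * cond_sf \<kappa> x u\<close> for \<open>s \<ge> 1\<close>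
(\<open>tail_ratio_power_bound\<close>). At \<open>x\<close> itself this is a Potter bound, obtained from a monotone tail and the
ratio at \<open>2\<close> alone; the Lipschitz conditions transfer it to neighbouring points at the price of a factor
\<open>(s * u) powr (c * h)\<close>, which is harmless exactly because \<open>h * ln u\<close> tends to \<open>0\<close>.
Conditioning on the covariate then bounds expectations, one pair \<open>(X j, Y j)\<close> at a time.\<close>

section \<open>Joint laws and convergence in probability\<close>

lemma regular_cond_dist_prob_space:
  assumes "regular_cond_dist M X Y \<kappa>"
  shows "prob_space (\<kappa> u)" "sets (\<kappa> u) = sets borel"
proof -
  have "\<kappa> u \<in> space (prob_algebra borel)"
    using assms by (auto simp: regular_cond_dist_def intro: measurable_space)
  then show "prob_space (\<kappa> u)" "sets (\<kappa> u) = sets borel" by (auto simp: space_prob_algebra)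
qed

text \<open>By disintegration, the image under \<open>X\<close> of \<open>M\<close> restricted to \<open>Y \<in> B\<close> has density \<open>\<lambda>u. emeasure (\<kappa> u) B\<close>
with respect to the law of \<open>X\<close>; this carries the defining identity from indicators of sets to
arbitrary weights such as a kernel.\<close>

lemma nn_integral_regular_cond_dist:
  fixes X Y :: "'a \<Rightarrow> real" and f :: "real \<Rightarrow> ennreal"
  assumes [measurable]: "X \<in> borel_measurable M" "Y \<in> borel_measurable M"
    and cd: "regular_cond_dist M X Y \<kappa>"
    and [measurable]: "f \<in> borel_measurable borel" "B \<in> sets borel"
  shows "(\<integral>\<^sup>+\<omega>. f (X \<omega>) * indicator B (Y \<omega>) \<partial>M)
    = (\<integral>\<^sup>+u. f u * emeasure (\<kappa> u) B \<partial>distr M borel X)"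
proof -
  have "\<kappa> \<in> measurable borel (prob_algebra borel)"
    using cd by (auto simp: regular_cond_dist_def)
  then have [measurable]: "\<kappa> \<in> measurable borel (subprob_algebra borel)"
    by (rule measurable_prob_algebraD)
  have k[measurable]: "(\<lambda>u. emeasure (\<kappa> u) B) \<in> borel_measurable borel"
    by measurable
  define D where "D = density M (\<lambda>\<omega>. indicator B (Y \<omega>) :: ennreal)"
  have XD[measurable]: "X \<in> borel_measurable D" by (simp add: D_def)
  have "distr D borel X = density (distr M borel X) (\<lambda>u. emeasure (\<kappa> u) B)"
  proof (rule measure_eqI)
    fix A assume "A \<in> sets (distr D borel X)"
    then have A[measurable]: "A \<in> sets borel" by simp
    have "emeasure (distr D borel X) A = emeasure D (X -` A \<inter> space M)"
      by (subst emeasure_distr) (auto simp: D_def)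
    also have "\<dots> = (\<integral>\<^sup>+\<omega>. indicator B (Y \<omega>) * indicator (X -` A \<inter> space M) \<omega> \<partial>M)"
      unfolding D_def by (rule emeasure_density) measurable
    also have "\<dots> = (\<integral>\<^sup>+\<omega>. indicator {\<omega> \<in> space M. X \<omega> \<in> A \<and> Y \<omega> \<in> B} \<omega> \<partial>M)"
      by (rule nn_integral_cong) (auto simp: indicator_def)
    also have "\<dots> = emeasure M {\<omega> \<in> space M. X \<omega> \<in> A \<and> Y \<omega> \<in> B}"
      by (rule nn_integral_indicator) measurable
    also have "\<dots> = (\<integral>\<^sup>+u\<in>A. emeasure (\<kappa> u) B \<partial>distr M borel X)"
      using cd A assms(5) unfolding regular_cond_dist_def by blast
    also have "\<dots> = emeasure (density (distr M borel X) (\<lambda>u. emeasure (\<kappa> u) B)) A"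
      by (rule emeasure_density[symmetric]) auto
    finally show "emeasure (distr D borel X) A = \<dots>" .
  qed simp
  then have "(\<integral>\<^sup>+u. f u \<partial>distr D borel X) = (\<integral>\<^sup>+u. emeasure (\<kappa> u) B * f u \<partial>distr M borel X)"
    by (simp add: nn_integral_density)
  moreover have "(\<integral>\<^sup>+u. f u \<partial>distr D borel X) = (\<integral>\<^sup>+\<omega>. indicator B (Y \<omega>) * f (X \<omega>) \<partial>M)"
    by (subst nn_integral_distr) (auto simp: D_def nn_integral_density)
  ultimately show ?thesis by (simp add: mult.commute)
qed

lemma stationary_distr:
  fixes Z :: "int \<Rightarrow> 'a \<Rightarrow> 'b::topological_space"
  assumes "stationary M Z"
  shows "distr M borel (Z j) = distr M borel (Z 0)"
proof -
  have [measurable]: "Z i \<in> borel_measurable M" for i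
    using assms by (auto simp: stationary_def)
  have "distr (distr M (\<Pi>\<^sub>M i\<in>{0::int}. borel) (\<lambda>\<omega>. \<lambda>i\<in>{0}. Z (i + m) \<omega>)) borel (\<lambda>f. f 0)
      = distr M borel (Z m)" for m
    by (subst distr_distr) (auto simp: comp_def)
  from this[of j] this[of 0] show ?thesis
    using assms by (auto simp: stationary_def)
qed

lemma conv_in_prob_finite_family:
  assumes "finite I" "finite_measure M"
    and Z: "\<And>i. i \<in> I \<Longrightarrow> conv_in_prob M (Z i) (c i)" and "e > 0"
  shows "(\<lambda>n. measure M {\<omega> \<in> space M. \<exists>i\<in>I. \<bar>Z i n \<omega> - c i\<bar> > e}) \<longlonglongrightarrow> 0"
proof -
  interpret finite_measure M by fact
  let ?E = "\<lambda>i n. {\<omega> \<in> space M. \<bar>Z i n \<omega> - c i\<bar> > e}"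
  have E: "?E i n \<in> sets M" if "i \<in> I" for i n
  proof -
    have [measurable]: "Z i n \<in> borel_measurable M"
      using Z[OF that] by (auto simp: conv_in_prob_def)
    show ?thesis by measurable
  qed
  have "(\<lambda>n. \<Sum>i\<in>I. measure M (?E i n)) \<longlonglongrightarrow> 0"
    using Z \<open>e > 0\<close> by (intro tendsto_null_sum) (auto simp: conv_in_prob_def)
  then show ?thesis
  proof (rule tendsto_sandwich[rotated 3])
    show "eventually (\<lambda>n. measure M {\<omega> \<in> space M. \<exists>i\<in>I. \<bar>Z i n \<omega> - c i\<bar> > e}
        \<le> (\<Sum>i\<in>I. measure M (?E i n))) sequentially"
    proof (rule always_eventually, rule allI)
      fix n
      have "{\<omega> \<in> space M. \<exists>i\<in>I. \<bar>Z i n \<omega> - c i\<bar> > e} = (\<Union>i\<in>I. ?E i n)" by auto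
      then show "measure M {\<omega> \<in> space M. \<exists>i\<in>I. \<bar>Z i n \<omega> - c i\<bar> > e}
        \<le> (\<Sum>i\<in>I. measure M (?E i n))"
        using finite_measure_subadditive_finite[OF \<open>finite I\<close>, of "\<lambda>i. ?E i n"] E
        by (metis (no_types, lifting) image_subsetI)
    qed
  qed auto
qed

section \<open>Measurability of the estimators\<close>

text \<open>The infimum is only a genuine one when the up-set \<open>{y. p \<le> F y}\<close> is nonempty and bounded below;
otherwise the up-set is empty or the whole line, and the value is one of two constants.\<close>

lemma borel_measurable_gen_inverse:
  fixes F :: "'a \<Rightarrow> real \<Rightarrow> real"
  assumes mono: "\<And>\<omega>. \<omega> \<in> space M \<Longrightarrow> mono (F \<omega>)"
    and meas: "\<And>y. (\<lambda>\<omega>. F \<omega> y) \<in> borel_measurable M"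
  shows "(\<lambda>\<omega>. gen_inverse (F \<omega>) p) \<in> borel_measurable M"
proof (rule borel_measurableI_less)
  fix y :: real
  note [measurable] = meas
  have up: "p \<le> F \<omega> b" if "\<omega> \<in> space M" "p \<le> F \<omega> a" "a \<le> b" for \<omega> a b
    using that monoD[OF mono[OF that(1)] that(3)] by simp
  \<comment> \<open>Integers decide whether the up-set is empty or all of the line; otherwise its infimum
    is genuine, and lies below \<open>y\<close> iff some rational below \<open>y\<close> belongs to the up-set.\<close>
  have iff: "gen_inverse (F \<omega>) p < y \<longleftrightarrow>
      (\<forall>i::int. \<not> p \<le> F \<omega> (of_int i)) \<and> Inf ({}::real set) < y \<or>
      (\<forall>i::int. p \<le> F \<omega> (of_int i)) \<and> Inf (UNIV::real set) < y \<or>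
      (\<exists>i::int. p \<le> F \<omega> (of_int i)) \<and> (\<exists>i::int. \<not> p \<le> F \<omega> (of_int i)) \<and>
      (\<exists>z::rat. of_rat z < y \<and> p \<le> F \<omega> (of_rat z))" if \<omega>: "\<omega> \<in> space M" for \<omega>
  proof -
    let ?S = "{y. p \<le> F \<omega> y}"
    consider (none) "\<forall>i::int. \<not> p \<le> F \<omega> (of_int i)" | (all) "\<forall>i::int. p \<le> F \<omega> (of_int i)"
      | (some) a b :: int where "p \<le> F \<omega> (of_int a)" "\<not> p \<le> F \<omega> (of_int b)" by blast
    then show ?thesis
    proof cases
      case none
      have "?S = {}"
        using none up[OF \<omega>, of _ "of_int \<lceil>_\<rceil>"] le_of_int_ceiling by blast
      then show ?thesis using none by (simp add: gen_inverse_def)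
    next
      case all
      have "?S = UNIV"
        using all up[OF \<omega>, of "of_int \<lfloor>_\<rfloor>"] of_int_floor_le by blast
      then show ?thesis using all by (simp add: gen_inverse_def)
    next
      case some
      have "of_int b \<le> z" if "z \<in> ?S" for z
        using some(2) up[OF \<omega>, of z "of_int b"] that by force
      then have bdd: "bdd_below ?S" by (rule bdd_belowI)
      have "gen_inverse (F \<omega>) p < y \<longleftrightarrow> (\<exists>z\<in>?S. z < y)"
        unfolding gen_inverse_def by (rule cInf_less_iff) (use some bdd in auto)
      also have "\<dots> \<longleftrightarrow> (\<exists>z::rat. of_rat z < y \<and> p \<le> F \<omega> (of_rat z))"
      proof
        assume "\<exists>z\<in>?S. z < y"
        then obtain z where z: "p \<le> F \<omega> z" "z < y" by blast
        from of_rat_dense[OF z(2)] obtain t where "z < of_rat t" "of_rat t < y" by blast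
        then show "\<exists>z::rat. of_rat z < y \<and> p \<le> F \<omega> (of_rat z)"
          using up[OF \<omega> z(1), of "of_rat t"] by auto
      qed auto
      finally show ?thesis using some by blast
    qed
  qed
  have "{\<omega> \<in> space M. gen_inverse (F \<omega>) p < y} = {\<omega> \<in> space M.
      (\<forall>i::int. \<not> p \<le> F \<omega> (of_int i)) \<and> Inf ({}::real set) < y \<or>
      (\<forall>i::int. p \<le> F \<omega> (of_int i)) \<and> Inf (UNIV::real set) < y \<or>
      (\<exists>i::int. p \<le> F \<omega> (of_int i)) \<and> (\<exists>i::int. \<not> p \<le> F \<omega> (of_int i)) \<and>
      (\<exists>z::rat. of_rat z < y \<and> p \<le> F \<omega> (of_rat z))}"
    using iff by blast
  also have "\<dots> \<in> sets M" by measurable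
  finally show "{\<omega> \<in> space M. gen_inverse (F \<omega>) p < y} \<in> sets M" .
qed

lemma mono_nw_cdf:
  assumes "\<And>v. K v \<ge> 0"
  shows "mono (\<lambda>y. 1 - nw_sf K h X Y x n \<omega> y)"
  unfolding nw_sf_def
  by (intro monoI diff_left_mono divide_right_mono sum_mono mult_left_mono sum_nonneg assms)
     (auto simp: indicator_def)

lemma borel_measurable_nw_quantile:
  fixes X Y :: "int \<Rightarrow> 'a \<Rightarrow> real" and K :: "real \<Rightarrow> real"
  assumes [measurable]: "\<And>j. X j \<in> borel_measurable M" "\<And>j. Y j \<in> borel_measurable M"
    "K \<in> borel_measurable borel"
    and K_nonneg: "\<And>v. K v \<ge> 0"
  shows "nw_quantile K h k X Y x n \<in> borel_measurable M"
proof -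
  have "mono (\<lambda>y. 1 - nw_sf K h X Y x n \<omega> y)" for \<omega>
    by (rule mono_nw_cdf[OF K_nonneg])
  moreover have "(\<lambda>\<omega>. 1 - nw_sf K h X Y x n \<omega> y) \<in> borel_measurable M" for y
    unfolding nw_sf_def by measurable
  ultimately have "(\<lambda>\<omega>. nw_quantile K h k X Y x n \<omega>) \<in> borel_measurable M"
    unfolding nw_quantile_def by (intro borel_measurable_gen_inverse)
  then show ?thesis by simp
qed

lemma borel_measurable_cond_hill:
  fixes X Y :: "int \<Rightarrow> 'a \<Rightarrow> real" and K :: "real \<Rightarrow> real"
  assumes [measurable]: "\<And>j. X j \<in> borel_measurable M" "\<And>j. Y j \<in> borel_measurable M"
    "K \<in> borel_measurable borel"
    and K_nonneg: "\<And>v. K v \<ge> 0"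
  shows "cond_hill \<kappa> K h k X Y x n \<in> borel_measurable M"
proof -
  note [measurable] = borel_measurable_nw_quantile[OF assms]
  have "(\<lambda>\<omega>. cond_hill \<kappa> K h k X Y x n \<omega>) \<in> borel_measurable M"
    unfolding cond_hill_def set_lebesgue_integral_def est_tail_def nw_sf_def indicator_def
    by measurable
  then show ?thesis by simp
qed

section \<open>The logarithm on a geometric grid\<close>

text \<open>Each grid point \<open>r ^ i\<close> below \<open>t\<close> accounts for one step \<open>ln r\<close> of the logarithm; the last, incomplete
step is rounded up here and down in the companion bound.\<close>

lemma log_plus_le_grid:
  fixes t r :: real
  assumes "r > 1" "t > 0"
  shows "max 0 (ln t) \<le> ln r * (\<Sum>i<m. indicator {z. z > r ^ i} t) + max 0 (ln (t / r ^ m))"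
proof (induction m)
  case (Suc m)
  have *: "max 0 (ln a) \<le> ln r * indicator {z. z > 1} a + max 0 (ln (a / r))" if "a > 0" for a
    using that \<open>r > 1\<close> by (auto simp: ln_div max_def indicator_def)
  have "max 0 (ln (t / r ^ m)) \<le> ln r * indicator {z. z > r ^ m} t + max 0 (ln (t / r ^ Suc m))"
    using *[of "t / r ^ m"] assms by (simp add: indicator_def field_simps)
  with Suc show ?case unfolding sum.lessThan_Suc distrib_left by linarith
qed simp

lemma grid_le_log_plus:
  fixes t r :: real
  assumes "r > 1" "t > 0"
  shows "ln r * (\<Sum>i<m. indicator {z. z > r ^ Suc i} t) \<le> max 0 (ln t)"
proof -
  have "ln r * (\<Sum>i<m. indicator {z. z > r ^ Suc i} t) + max 0 (ln (t / r ^ m)) \<le> max 0 (ln t)"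
  proof (induction m)
    case (Suc m)
    have *: "ln r * indicator {z. z > r} a + max 0 (ln (a / r)) \<le> max 0 (ln a)" if "a > 0" for a
      using that \<open>r > 1\<close> ln_le_cancel_iff[of a r]  by (auto simp: ln_div max_def indicator_def)
    have "ln r * indicator {z. z > r ^ Suc m} t + max 0 (ln (t / r ^ Suc m)) \<le> max 0 (ln (t / r ^ m))"
      using *[of "t / r ^ m"] assms by (simp add: indicator_def field_simps)
    with Suc show ?case unfolding sum.lessThan_Suc distrib_left by linarith
  qed simp
  then show ?thesis by (simp add: max_def split: if_splits)
qed

text \<open>As the step tends to \<open>0\<close>, the geometric series arising as upper and lower Riemann sums of
\<open>s powr - \<alpha> / s\<close> on the grid both tend to \<open>1 / \<alpha>\<close>. The factor \<open>1 / \<rho>\<close> reflects that the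
upper sum starts one grid point below \<open>1\<close>, the factor \<open>\<rho>\<^sup>2\<close> that the lower sum starts two
points above: one for the rounding and one for the location of the quantile.\<close>

lemma exists_grid_ratio:
  fixes \<alpha> \<epsilon> :: real
  assumes "\<alpha> > 0" "\<epsilon> > 0"
  obtains r \<rho> :: real where "r > 1" "\<rho> = r powr - \<alpha>" "0 < \<rho>" "\<rho> < 1"
    "ln r / (\<rho> * (1 - \<rho>)) < 1 / \<alpha> + \<epsilon>" "ln r * (\<rho>\<^sup>2 / (1 - \<rho>)) > 1 / \<alpha> - \<epsilon>"
proof -
  have "((\<lambda>t. t / (exp (- \<alpha> * t) * (1 - exp (- \<alpha> * t)))) \<longlongrightarrow> inverse \<alpha>) (at_right 0)"
    using assms by real_asymp
  from order_tendstoD(2)[OF this, of "1 / \<alpha> + \<epsilon>"] assms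
  have "\<forall>\<^sub>F t in at_right 0. t / (exp (- \<alpha> * t) * (1 - exp (- \<alpha> * t))) < 1 / \<alpha> + \<epsilon>" by (simp add: inverse_eq_divide)
  moreover have "((\<lambda>t. t * ((exp (- \<alpha> * t))\<^sup>2 / (1 - exp (- \<alpha> * t)))) \<longlongrightarrow> inverse \<alpha>) (at_right 0)"
    using assms by real_asymp
  from order_tendstoD(1)[OF this, of "1 / \<alpha> - \<epsilon>"] assms
  have "\<forall>\<^sub>F t in at_right 0. t * ((exp (- \<alpha> * t))\<^sup>2 / (1 - exp (- \<alpha> * t))) > 1 / \<alpha> - \<epsilon>" by (simp add: inverse_eq_divide)
  moreover have "\<forall>\<^sub>F t :: real in at_right 0. t > 0"
    by (rule eventually_at_right_less)
  ultimately have "\<forall>\<^sub>F t in at_right 0. t > 0 \<and>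
      t / (exp (- \<alpha> * t) * (1 - exp (- \<alpha> * t))) < 1 / \<alpha> + \<epsilon> \<and>
      t * ((exp (- \<alpha> * t))\<^sup>2 / (1 - exp (- \<alpha> * t))) > 1 / \<alpha> - \<epsilon>"
    by eventually_elim simp
  then obtain t :: real where "t > 0" "t / (exp (- \<alpha> * t) * (1 - exp (- \<alpha> * t))) < 1 / \<alpha> + \<epsilon>"
      "t * ((exp (- \<alpha> * t))\<^sup>2 / (1 - exp (- \<alpha> * t))) > 1 / \<alpha> - \<epsilon>"
    using eventually_happens'[OF trivial_limit_at_right_real[of 0]] by blast
  then show ?thesis
    using that[of "exp t" "exp (- \<alpha> * t)"] assms by (simp add: powr_def)
qed

section \<open>Power bounds for regularly varying tails\<close>

lemma regularly_varying_tail_pos: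
  fixes F L :: "real \<Rightarrow> real"
  assumes anti: "antimono F" and sv: "slowly_varying L"
    and F: "\<And>y. y > 0 \<Longrightarrow> F y = L y * y powr a"
  shows "F y > 0"
proof -
  obtain b where b: "\<And>y. y \<ge> b \<Longrightarrow> L y > 0"
    using sv by (auto simp: slowly_varying_def)
  define z where "z = max y (max b 1)"
  have "0 < L z * z powr a"
    using b[of z] by (intro mult_pos_pos) (auto simp: z_def)
  also have "\<dots> = F z" using F[of z] by (simp add: z_def)
  also have "\<dots> \<le> F y" by (rule antimonoD[OF anti]) (simp add: z_def)
  finally show ?thesis .
qed

text \<open>A weak Potter bound: iterating the doubling inequality gives the decay along \<open>2 ^ m * y\<close>, and
monotonicity fills the gaps at the cost of the constant \<open>2 powr \<delta>\<close>.\<close>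

lemma doubling_imp_power_decay:
  fixes F :: "real \<Rightarrow> real"
  assumes anti: "antimono F" and nonneg: "\<And>y. F y \<ge> 0"
    and "\<delta> > 0" "y\<^sub>1 > 0"
    and double: "\<And>y. y \<ge> y\<^sub>1 \<Longrightarrow> F (2 * y) \<le> 2 powr - \<delta> * F y"
    and "s \<ge> 1" "y \<ge> y\<^sub>1"
  shows "F (s * y) \<le> 2 powr \<delta> * s powr - \<delta> * F y"
proof -
  have "F (s * y) \<le> 2 powr \<delta> * s powr - \<delta> * F y" if "s < 2 ^ m" "s \<ge> 1" for m s
    using that
  proof (induction m arbitrary: s)
    case (Suc m)
    show ?case
    proof (cases "s < 2")
      case True
      have "2 powr \<delta> * s powr - \<delta> = (2 / s) powr \<delta>"
        using Suc by (simp add: powr_divide powr_minus_divide)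
      also have "\<dots> \<ge> 1" using True Suc \<open>\<delta> > 0\<close> by (intro ge_one_powr_ge_zero) auto
      finally have "F y \<le> 2 powr \<delta> * s powr - \<delta> * F y"
        using mult_right_mono[of 1 _ "F y"] nonneg[of y] by simp
      moreover have "F (s * y) \<le> F y"
        using Suc assms by (intro antimonoD[OF anti]) auto
      ultimately show ?thesis by simp
    next
      case False
      have "y\<^sub>1 \<le> s / 2 * y"
        using False assms mult_mono[of 1 "s/2" y\<^sub>1 y] by auto
      then have "F (s * y) \<le> 2 powr - \<delta> * F (s / 2 * y)"
        using double[of "s / 2 * y"] by simp
      also have "\<dots> \<le> 2 powr - \<delta> * (2 powr \<delta> * (s / 2) powr - \<delta> * F y)"
        using Suc False by (intro mult_left_mono Suc.IH) auto
      also have "\<dots> = 2 powr \<delta> * s powr - \<delta> * F y"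
        using False by (simp add: powr_divide powr_minus field_simps)
      finally show ?thesis .
    qed
  qed auto
  moreover obtain m where "s < 2 ^ m" using real_arch_pow[of 2 s] by auto
  ultimately show ?thesis using \<open>s \<ge> 1\<close> by blast
qed

text \<open>The decay is uniform over the bandwidth window: \<open>G u\<close> is compared with \<open>G x\<close> at the same argument
\<open>s * v n\<close>, and then \<open>G x\<close> at \<open>s * v n\<close> with \<open>G x\<close> at \<open>v n\<close>.\<close>

lemma tail_ratio_power_bound:
  fixes G L :: "real \<Rightarrow> real \<Rightarrow> real" and \<gamma> :: "real \<Rightarrow> real" and v h :: "nat \<Rightarrow> real"
  assumes U: "x \<in> U" "open U"
    and gamma_pos: "\<gamma> x > 0"
    and anti: "\<And>u. u \<in> U \<Longrightarrow> antimono (G u)" and nonneg: "\<And>u y. u \<in> U \<Longrightarrow> G u y \<ge> 0"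
    and L_sv: "\<And>u. u \<in> U \<Longrightarrow> slowly_varying (L u)"
    and reg_var: "\<And>u y. u \<in> U \<Longrightarrow> y > 0 \<Longrightarrow> G u y = L u y * y powr (- 1 / \<gamma> u)"
    and C1: "c\<^sub>\<gamma>-lipschitz_on U (\<lambda>u. 1 / \<gamma> u)"
    and C3: "y\<^sub>0 > 1" "c\<^sub>L > 0" "\<And>u v y. u \<in> U \<Longrightarrow> v \<in> U \<Longrightarrow> y \<ge> y\<^sub>0 \<Longrightarrow>
          \<bar>(ln (L v y) - ln (L u y)) / ln y\<bar> \<le> c\<^sub>L * \<bar>v - u\<bar>"
    and h_pos: "\<And>n. h n > 0" and h_lim: "h \<longlonglongrightarrow> 0"
    and v_lim: "filterlim v at_top sequentially" and hv_lim: "(\<lambda>n. h n * ln (v n)) \<longlonglongrightarrow> 0"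
  obtains C \<delta> where "C > 0" "\<delta> > 0"
    "\<forall>\<^sub>F n in sequentially. \<forall>s\<ge>1. \<forall>u. \<bar>u - x\<bar> \<le> h n \<longrightarrow>
       G u (s * v n) \<le> C * s powr - \<delta> * G x (v n)"
proof -
  have G_pos: "G u y > 0" if u: "u \<in> U" for u y
    by (rule regularly_varying_tail_pos[OF anti[OF u] L_sv[OF u] reg_var[OF u]])
  have L_pos: "L u y > 0" if "u \<in> U" "y > 0" for u y
    using G_pos[OF that(1), of y] reg_var[OF that] by (simp add: zero_less_mult_iff)
  define c where "c = c\<^sub>L + c\<^sub>\<gamma>"
  have c_pos: "c > 0" using C3(2) lipschitz_on_nonneg[OF C1] by (simp add: c_def)
  \<comment> \<open>Comparison of the laws at \<open>u\<close> and at \<open>x\<close>: index and slowly varying factor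
    each cost a power of \<open>y\<close> with exponent of order \<open>\<bar>u - x\<bar>\<close>.\<close>
  have local: "G u y \<le> y powr (c * \<bar>u - x\<bar>) * G x y" if u: "u \<in> U" and y: "y \<ge> y\<^sub>0" for u y
  proof -
    have y1: "y > 1" "ln y > 0" using y C3(1) by auto
    have "ln (L u y) - ln (L x y) \<le> c\<^sub>L * \<bar>u - x\<bar> * ln y"
      using C3(3)[OF U(1) u y] y1 by (simp add: pos_divide_le_eq)
    moreover have "(1 / \<gamma> x - 1 / \<gamma> u) * ln y \<le> c\<^sub>\<gamma> * \<bar>u - x\<bar> * ln y"
      using lipschitz_onD[OF C1 u U(1)] y1 by (intro mult_right_mono) (auto simp: dist_real_def)
    ultimately have "ln (L u y) - 1 / \<gamma> u * ln y \<le>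
        c * \<bar>u - x\<bar> * ln y + (ln (L x y) - 1 / \<gamma> x * ln y)"
      by (simp add: c_def algebra_simps)
    then have "exp (ln (L u y) - 1 / \<gamma> u * ln y) \<le>
        exp (c * \<bar>u - x\<bar> * ln y) * exp (ln (L x y) - 1 / \<gamma> x * ln y)"
      by (simp flip: exp_add)
    moreover have "exp (ln (L w y) - 1 / \<gamma> w * ln y) = G w y" if "w \<in> U" for w
      using reg_var[OF that, of y] L_pos[OF that, of y] y1
      by (simp add: exp_diff powr_def exp_minus field_simps)
    ultimately show ?thesis using u U(1) y1 by (simp add: powr_def)
  qed
  \<comment> \<open>The tail at \<open>x\<close> decays with exponent \<open>4 * \<delta>\<close>. Exponent \<open>2 * \<delta>\<close> leaves room for a strict
    inequality in the doubling argument, and the comparison with neighbouring laws costs another \<open>\<delta>\<close>.\<close>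
  define \<delta> where "\<delta> = 1 / (4 * \<gamma> x)"
  have d: "\<delta> > 0" using gamma_pos by (simp add: \<delta>_def)
  have "((\<lambda>y. L x (2 * y) / L x y * 2 powr (- 1 / \<gamma> x)) \<longlongrightarrow> 1 * 2 powr (- 1 / \<gamma> x)) at_top"
    using L_sv[OF U(1)] by (intro tendsto_mult) (auto simp: slowly_varying_def)
  moreover have "1 * 2 powr (- 1 / \<gamma> x) < (2::real) powr - (2 * \<delta>)"
    using gamma_pos by (simp add: \<delta>_def field_simps)
  ultimately have "\<forall>\<^sub>F y in at_top. L x (2 * y) / L x y * 2 powr (- 1 / \<gamma> x) < 2 powr - (2 * \<delta>)"
    by (rule order_tendstoD)
  then obtain y\<^sub>2 where y2: "\<And>y. y \<ge> y\<^sub>2 \<Longrightarrow>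
      L x (2 * y) / L x y * 2 powr (- 1 / \<gamma> x) < 2 powr - (2 * \<delta>)"
    by (auto simp: eventually_at_top_linorder)
  define y\<^sub>1 where "y\<^sub>1 = max y\<^sub>2 1"
  have double: "G x (2 * y) \<le> 2 powr - (2 * \<delta>) * G x y" if "y \<ge> y\<^sub>1" for y
  proof -
    have y: "y > 0" "y \<ge> y\<^sub>2" using that by (auto simp: y\<^sub>1_def)
    have "G x (2 * y) = L x (2 * y) / L x y * 2 powr (- 1 / \<gamma> x) * G x y"
      using reg_var[OF U(1), of y] reg_var[OF U(1), of "2 * y"] y L_pos[OF U(1), of y]
      by (simp add: powr_mult)
    also have "\<dots> \<le> 2 powr - (2 * \<delta>) * G x y"
      using y2[OF y(2)] nonneg[OF U(1)] by (intro mult_right_mono) auto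
    finally show ?thesis .
  qed
  have potter: "G x (s * y) \<le> 2 powr (2 * \<delta>) * s powr - (2 * \<delta>) * G x y"
    if "s \<ge> 1" "y \<ge> y\<^sub>1" for s y
    using doubling_imp_power_decay[of "G x" "2 * \<delta>" y\<^sub>1 s y] anti nonneg U d that double
    by (simp add: y\<^sub>1_def)
  obtain \<epsilon> where e: "\<epsilon> > 0" "cball x \<epsilon> \<subseteq> U" using U open_contains_cball by blast
  have "(\<lambda>n. c * h n) \<longlonglongrightarrow> c * 0" "(\<lambda>n. c * (h n * ln (v n))) \<longlonglongrightarrow> c * 0"
    by (intro tendsto_mult tendsto_const h_lim hv_lim)+
  then have ev: "\<forall>\<^sub>F n in sequentially. c * h n < \<delta>"
      "\<forall>\<^sub>F n in sequentially. c * (h n * ln (v n)) < 1"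
    using d by (auto intro: order_tendstoD)
  have "\<forall>\<^sub>F n in sequentially. h n < \<epsilon>" using h_lim e by (auto intro: order_tendstoD)
  moreover have "\<forall>\<^sub>F n in sequentially. v n \<ge> max y\<^sub>0 y\<^sub>1"
    using v_lim unfolding filterlim_at_top by blast
  ultimately have "\<forall>\<^sub>F n in sequentially. \<forall>s\<ge>1. \<forall>u. \<bar>u - x\<bar> \<le> h n \<longrightarrow>
       G u (s * v n) \<le> (exp 1 * 2 powr (2 * \<delta>)) * s powr - \<delta> * G x (v n)"
    using ev
  proof eventually_elim
    case (elim n)
    show ?case
    proof (intro allI impI)
      fix s u :: real assume su: "s \<ge> 1" "\<bar>u - x\<bar> \<le> h n"
      have u: "u \<in> U" using e elim su by (auto simp: dist_real_def subset_iff)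
      have v: "v n \<ge> y\<^sub>0" "v n \<ge> y\<^sub>1" "v n \<ge> 1" using elim by (auto simp: y\<^sub>1_def)
      have sv: "s * v n \<ge> v n" using su v mult_right_mono[of 1 s "v n"] by simp
      then have sv1: "s * v n \<ge> 1" using v by linarith
      have "(s * v n) powr (c * \<bar>u - x\<bar>) \<le> (s * v n) powr (c * h n)"
        using sv1 su c_pos by (intro powr_mono mult_left_mono) auto
      \<comment> \<open>Here the rate condition enters: the factor coming from \<open>v n\<close> is \<open>exp (c * h n * ln (v n))\<close>.\<close>
      also have "\<dots> = s powr (c * h n) * exp (c * (h n * ln (v n)))"
        using su v by (simp add: powr_mult) (simp add: powr_def mult_ac)
      also have "\<dots> \<le> s powr \<delta> * exp 1"
        using elim su by (intro mult_mono powr_mono) auto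
      finally have *: "(s * v n) powr (c * \<bar>u - x\<bar>) \<le> s powr \<delta> * exp 1" .
      have "G u (s * v n) \<le> (s * v n) powr (c * \<bar>u - x\<bar>) * G x (s * v n)"
        by (rule local[OF u order_trans[OF v(1) sv]])
      also have "\<dots> \<le> (s powr \<delta> * exp 1) * (2 powr (2 * \<delta>) * s powr - (2 * \<delta>) * G x (v n))"
        using * potter[of s "v n"] su v nonneg[OF U(1)] by (intro mult_mono) auto
      also have "\<dots> = (exp 1 * 2 powr (2 * \<delta>)) * (s powr \<delta> * s powr - (2 * \<delta>)) * G x (v n)"
        by (simp add: mult_ac)
      also have "s powr \<delta> * s powr - (2 * \<delta>) = s powr - \<delta>" by (simp flip: powr_add)
      finally show "G u (s * v n) \<le> (exp 1 * 2 powr (2 * \<delta>)) * s powr - \<delta> * G x (v n)" .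
    qed
  qed
  then show ?thesis using that[of "exp 1 * 2 powr (2 * \<delta>)" \<delta>] d by simp
qed

section \<open>The contribution of large observations\<close>

text \<open>Divided by the kernel density estimate and by \<open>k n / n\<close>, this is the Hill estimator with the
empirical quantile replaced by a given level \<open>v\<close>.\<close>

definition log_excess ::
  "(real \<Rightarrow> real) \<Rightarrow> (nat \<Rightarrow> real) \<Rightarrow> (int \<Rightarrow> 'a \<Rightarrow> real) \<Rightarrow> (int \<Rightarrow> 'a \<Rightarrow> real) \<Rightarrow>
   real \<Rightarrow> nat \<Rightarrow> real \<Rightarrow> 'a \<Rightarrow> real" where
  "log_excess K h X Y x n v \<omega> =
     1 / (real n * h n) *
     (\<Sum>j=1..n. K ((x - X (int j) \<omega>) / h n) * max 0 (ln (Y (int j) \<omega> / v)))"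

text \<open>The kernel confines the covariate to the window of half-width \<open>\<eta>\<close> around \<open>x\<close>, where the density
and the conditional tail are bounded; the window has length \<open>2 * \<eta>\<close>.\<close>

lemma expected_kernel_tail_le:
  fixes X Y :: "int \<Rightarrow> 'a \<Rightarrow> real" and g K :: "real \<Rightarrow> real"
  assumes [measurable]: "\<And>j. X j \<in> borel_measurable M" "\<And>j. Y j \<in> borel_measurable M"
    and stat: "stationary M (\<lambda>j \<omega>. (X j \<omega>, Y j \<omega>))"
    and g_density: "distributed M lborel (X 0) (\<lambda>u. ennreal (g u))"
    and cd: "regular_cond_dist M (X 0) (Y 0) \<kappa>"
    and [measurable]: "K \<in> borel_measurable borel"
    and K: "\<And>v. 0 \<le> K v" "\<And>v. K v \<le> b\<^sub>K" "\<And>v. v \<notin> {-1..1} \<Longrightarrow> K v = 0"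
    and "\<eta> > 0"
    and g: "\<And>u. \<bar>u - x\<bar> \<le> \<eta> \<Longrightarrow> 0 \<le> g u \<and> g u \<le> b\<^sub>g"
    and sf: "\<And>u. \<bar>u - x\<bar> \<le> \<eta> \<Longrightarrow> cond_sf \<kappa> u y \<le> p"
  shows "(\<integral>\<^sup>+\<omega>. ennreal (K ((x - X j \<omega>) / \<eta>) * indicator {z. z > y} (Y j \<omega>)) \<partial>M)
    \<le> ennreal (2 * \<eta> * (b\<^sub>K * b\<^sub>g * p))"
proof -
  let ?f = "\<lambda>u. ennreal (K ((x - u) / \<eta>))"
  note kappa = regular_cond_dist_prob_space[OF cd]
  have sf_eq: "emeasure (\<kappa> u) {z. z > y} = ennreal (cond_sf \<kappa> u y)" for u
  proof -
    interpret prob_space "\<kappa> u" by (rule kappa)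
    have sp: "space (\<kappa> u) = UNIV" using sets_eq_imp_space_eq[OF kappa(2)] by simp
    have "prob {z. z > y} = 1 - prob {..y}"
      using prob_compl[of "{..y}"] kappa(2) sp by (simp add: Compl_eq_Diff_UNIV[symmetric] greaterThan_def[symmetric])
    then show ?thesis by (simp add: emeasure_eq_measure cond_sf_def cdf_def)
  qed
  have meas: "(\<lambda>z::real \<times> real. ?f (fst z) * indicator {z. z > y} (snd z)) \<in> borel_measurable borel"
    unfolding borel_prod[symmetric] by measurable
  have pair: "(\<lambda>\<omega>. (X i \<omega>, Y i \<omega>)) \<in> borel_measurable M" for i
    using stat by (auto simp: stationary_def)
  have "(\<integral>\<^sup>+\<omega>. ennreal (K ((x - X j \<omega>) / \<eta>) * indicator {z. z > y} (Y j \<omega>)) \<partial>M)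
    = (\<integral>\<^sup>+\<omega>. ?f (X j \<omega>) * indicator {z. z > y} (Y j \<omega>) \<partial>M)"
    by (rule nn_integral_cong) (auto simp: indicator_def)
  also have "\<dots> = (\<integral>\<^sup>+z. ?f (fst z) * indicator {z. z > y} (snd z) \<partial>distr M borel (\<lambda>\<omega>. (X j \<omega>, Y j \<omega>)))"
    by (subst nn_integral_distr) (use meas pair in auto)
  also have "\<dots> = (\<integral>\<^sup>+z. ?f (fst z) * indicator {z. z > y} (snd z) \<partial>distr M borel (\<lambda>\<omega>. (X 0 \<omega>, Y 0 \<omega>)))"
    by (simp only: stationary_distr[OF stat, of j])
  also have "\<dots> = (\<integral>\<^sup>+\<omega>. ?f (X 0 \<omega>) * indicator {z. z > y} (Y 0 \<omega>) \<partial>M)"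
    by (subst nn_integral_distr) (use meas pair in auto)
  also have "\<dots> = (\<integral>\<^sup>+u. ?f u * emeasure (\<kappa> u) {z. z > y} \<partial>distr M borel (X 0))"
    by (rule nn_integral_regular_cond_dist[OF _ _ cd]) auto
  also have "\<dots> = (\<integral>\<^sup>+u. ?f u * ennreal (cond_sf \<kappa> u y) \<partial>distr M borel (X 0))"
    by (simp add: sf_eq)
  also have "distr M borel (X 0) = density lborel (\<lambda>u. ennreal (g u))"
    using distributed_distr_eq_density[OF g_density] by (simp cong: distr_cong)
  also have "(\<integral>\<^sup>+u. ?f u * ennreal (cond_sf \<kappa> u y) \<partial>density lborel (\<lambda>u. ennreal (g u)))
      = (\<integral>\<^sup>+u. ennreal (g u) * (?f u * ennreal (cond_sf \<kappa> u y)) \<partial>lborel)"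
  proof (rule nn_integral_density)
    have \<kappa>: "\<kappa> \<in> measurable borel (subprob_algebra borel)"
      using cd by (auto simp: regular_cond_dist_def intro: measurable_prob_algebraD)
    have [measurable]: "(\<lambda>u. ennreal (cond_sf \<kappa> u y)) \<in> borel_measurable borel"
      unfolding sf_eq[symmetric] using \<kappa> by measurable
    show "(\<lambda>u. ?f u * ennreal (cond_sf \<kappa> u y)) \<in> borel_measurable lborel" by measurable
  qed (use g_density in \<open>auto simp: distributed_def\<close>)
  also have "\<dots> \<le> (\<integral>\<^sup>+u. ennreal (b\<^sub>K * b\<^sub>g * p) * indicator {x - \<eta>..x + \<eta>} u \<partial>lborel)"
  proof (rule nn_integral_mono)
    fix u
    show "ennreal (g u) * (?f u * ennreal (cond_sf \<kappa> u y))
      \<le> ennreal (b\<^sub>K * b\<^sub>g * p) * indicator {x - \<eta>..x + \<eta>} u"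
    proof (cases "u \<in> {x - \<eta>..x + \<eta>}")
      case True
      then have u: "\<bar>u - x\<bar> \<le> \<eta>" by auto
      have "0 \<le> cond_sf \<kappa> u y"
        using kappa(1)[of u] by (simp add: cond_sf_def cdf_def prob_space.prob_le_1)
      then have "ennreal (g u) * (?f u * ennreal (cond_sf \<kappa> u y))
          = ennreal (g u * (K ((x - u) / \<eta>) * cond_sf \<kappa> u y))"
        using g[OF u] K(1) by (simp add: ennreal_mult')
      also have "\<dots> \<le> ennreal (b\<^sub>g * (b\<^sub>K * p))"
        using g[OF u] sf[OF u] K(1) K(2) \<open>0 \<le> cond_sf \<kappa> u y\<close> order_trans[OF K(1) K(2)]
        by (intro ennreal_leI mult_mono) auto
      finally show ?thesis using True by (simp add: mult_ac)
    next
      case False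
      then have "(x - u) / \<eta> \<notin> {-1..1}" using \<open>\<eta> > 0\<close> by (auto simp: field_simps)
      then show ?thesis using K(3) by simp
    qed
  qed
  also have "\<dots> = ennreal (b\<^sub>K * b\<^sub>g * p) * ennreal (2 * \<eta>)"
    using \<open>\<eta> > 0\<close> by (subst nn_integral_cmult_indicator) auto
  also have "\<dots> = ennreal (2 * \<eta> * (b\<^sub>K * b\<^sub>g * p))"
    using \<open>\<eta> > 0\<close> by (subst mult.commute) (simp add: ennreal_mult' [symmetric])
  finally show ?thesis .
qed

lemma ennreal_log_plus_le_suminf:
  fixes t :: real
  assumes "t > 0"
  shows "ennreal (max 0 (ln t)) \<le> (\<Sum>i. ennreal (ln 2 * indicator {z. z > 2 ^ i} t))"
proof -
  obtain m where m: "t < 2 ^ m" using real_arch_pow[of 2 t] by auto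
  have "max 0 (ln t) \<le> (\<Sum>i<m. ln 2 * indicator {z. z > 2 ^ i} t) + max 0 (ln (t / 2 ^ m))"
    using log_plus_le_grid[of 2 t m] assms by (simp add: sum_distrib_left)
  also have "max 0 (ln (t / 2 ^ m)) = 0"
    using m assms by (simp add: max_def)
  finally have "ennreal (max 0 (ln t)) \<le> ennreal (\<Sum>i<m. ln 2 * indicator {z. z > 2 ^ i} t)"
    by (intro ennreal_leI) simp
  also have "\<dots> = (\<Sum>i<m. ennreal (ln 2 * indicator {z. z > 2 ^ i} t))"
    by (rule sum_ennreal[symmetric]) simp
  also have "\<dots> \<le> (\<Sum>i. ennreal (ln 2 * indicator {z. z > 2 ^ i} t))"
    by (rule sum_le_suminf) auto
  finally show ?thesis .
qed

text \<open>The log-excess over \<open>b * v\<close> is at most \<open>ln 2\<close> times the number of levels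
\<open>b * 2 ^ i * v\<close> exceeded, and the bounds on the mean exceedances form a geometric series with ratio \<open>2 powr - \<delta>\<close>. The division by the bandwidth cancels the length
of the kernel window.\<close>

lemma expected_log_excess_le:
  fixes X Y :: "int \<Rightarrow> 'a \<Rightarrow> real" and g K :: "real \<Rightarrow> real"
  assumes [measurable]: "\<And>j. X j \<in> borel_measurable M" "\<And>j. Y j \<in> borel_measurable M"
    and Y_pos: "\<And>j \<omega>. \<omega> \<in> space M \<Longrightarrow> Y j \<omega> > 0"
    and stat: "stationary M (\<lambda>j \<omega>. (X j \<omega>, Y j \<omega>))"
    and g_density: "distributed M lborel (X 0) (\<lambda>u. ennreal (g u))"
    and cd: "regular_cond_dist M (X 0) (Y 0) \<kappa>"
    and [measurable]: "K \<in> borel_measurable borel"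
    and K: "\<And>v. 0 \<le> K v" "\<And>v. K v \<le> b\<^sub>K" "\<And>v. v \<notin> {-1..1} \<Longrightarrow> K v = 0"
    and pos: "n > 0" "h n > 0" "v > 0" "b \<ge> 1" "\<delta> > 0" "C \<ge> 0" "p \<ge> 0"
    and g: "\<And>u. \<bar>u - x\<bar> \<le> h n \<Longrightarrow> 0 \<le> g u \<and> g u \<le> b\<^sub>g"
    and sf: "\<And>u s. \<bar>u - x\<bar> \<le> h n \<Longrightarrow> s \<ge> 1 \<Longrightarrow> cond_sf \<kappa> u (s * v) \<le> C * s powr - \<delta> * p"
  shows "(\<integral>\<^sup>+\<omega>. ennreal (log_excess K h X Y x n (b * v) \<omega>) \<partial>M)
    \<le> ennreal (2 * b\<^sub>K * b\<^sub>g * C * ln 2 / (1 - 2 powr - \<delta>) * b powr - \<delta> * p)"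
proof -
  let ?w = "\<lambda>j \<omega>. K ((x - X j \<omega>) / h n)"
  define A where "A = 2 * h n * b\<^sub>K * b\<^sub>g * C * ln 2 * b powr - \<delta> * p"
  have bK: "b\<^sub>K \<ge> 0" using order_trans[OF K(1) K(2)] .
  have bg: "b\<^sub>g \<ge> 0" using g[of x] pos by auto
  have A: "A \<ge> 0" using bK bg pos by (simp add: A_def)
  define q :: real where "q = 2 powr - \<delta>"
  have q: "0 < q" "q < 1" using pos by (auto simp: q_def powr_minus_divide)
  have one: "(\<integral>\<^sup>+\<omega>. ennreal (?w j \<omega> * max 0 (ln (Y j \<omega> / (b * v)))) \<partial>M) \<le> ennreal (A / (1 - q))"
    for j
  proof -
    have "(\<integral>\<^sup>+\<omega>. ennreal (?w j \<omega> * max 0 (ln (Y j \<omega> / (b * v)))) \<partial>M)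
      \<le> (\<integral>\<^sup>+\<omega>. (\<Sum>i. ennreal (ln 2) * ennreal (?w j \<omega> * indicator {z. z > b * 2 ^ i * v} (Y j \<omega>))) \<partial>M)"
    proof (rule nn_integral_mono)
      fix \<omega> assume "\<omega> \<in> space M"
      then have Y: "Y j \<omega> / (b * v) > 0" using Y_pos pos by simp
      have "ennreal (?w j \<omega> * max 0 (ln (Y j \<omega> / (b * v))))
          = ennreal (?w j \<omega>) * ennreal (max 0 (ln (Y j \<omega> / (b * v))))"
        using K(1) by (simp add: ennreal_mult')
      also have "\<dots> \<le> ennreal (?w j \<omega>) *
          (\<Sum>i. ennreal (ln 2 * indicator {z. z > 2 ^ i} (Y j \<omega> / (b * v))))"
        by (intro mult_left_mono ennreal_log_plus_le_suminf Y) auto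
      also have "\<dots> = (\<Sum>i. ennreal (?w j \<omega>) * ennreal (ln 2 * indicator {z. z > 2 ^ i} (Y j \<omega> / (b * v))))"
        by simp
      also have "\<dots> = (\<Sum>i. ennreal (ln 2) * ennreal (?w j \<omega> * indicator {z. z > b * 2 ^ i * v} (Y j \<omega>)))"
        using K(1) pos by (intro suminf_cong) (auto simp: indicator_def ennreal_mult'[symmetric] field_simps)
      finally show "ennreal (?w j \<omega> * max 0 (ln (Y j \<omega> / (b * v)))) \<le> \<dots>" .
    qed
    also have "\<dots> = (\<Sum>i. ennreal (ln 2) *
        (\<integral>\<^sup>+\<omega>. ennreal (?w j \<omega> * indicator {z. z > b * 2 ^ i * v} (Y j \<omega>)) \<partial>M))"
      by (subst nn_integral_suminf) (auto simp: nn_integral_cmult)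
    also have "\<dots> \<le> (\<Sum>i. ennreal (A * q ^ i))"
    proof (rule suminf_le)
      fix i :: nat
      have "(2 ^ i :: real) powr - \<delta> = q ^ i"
        by (simp add: q_def powr_realpow[symmetric] powr_powr mult.commute)
      then have s: "(b * 2 ^ i) powr - \<delta> = b powr - \<delta> * q ^ i"
        using pos by (simp add: powr_mult)
      have s1: "b * 2 ^ i \<ge> 1" using pos mult_mono[of 1 b 1 "2 ^ i"] by simp
      have "ennreal (ln 2) * (\<integral>\<^sup>+\<omega>. ennreal (?w j \<omega> * indicator {z. z > b * 2 ^ i * v} (Y j \<omega>)) \<partial>M)
        \<le> ennreal (ln 2) * ennreal (2 * h n * (b\<^sub>K * b\<^sub>g * (C * (b * 2 ^ i) powr - \<delta> * p)))"
        by (intro mult_left_mono expected_kernel_tail_le[OF _ _ stat g_density cd])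
           (use K g sf[OF _ s1] pos in auto)
      also have "\<dots> = ennreal (A * q ^ i)"
        using s by (simp add: ennreal_mult'[symmetric] A_def mult_ac)
      finally show "ennreal (ln 2) * (\<integral>\<^sup>+\<omega>. ennreal (?w j \<omega> * indicator {z. z > b * 2 ^ i * v} (Y j \<omega>)) \<partial>M)
        \<le> ennreal (A * q ^ i)" .
    qed auto
    also have "\<dots> = ennreal (A * (1 / (1 - q)))"
      using A q by (intro suminf_ennreal_eq sums_mult geometric_sums) auto
    finally show ?thesis by simp
  qed
  have "(\<integral>\<^sup>+\<omega>. ennreal (log_excess K h X Y x n (b * v) \<omega>) \<partial>M)
    = (\<integral>\<^sup>+\<omega>. ennreal (1 / (real n * h n)) *
        (\<Sum>j=1..n. ennreal (?w j \<omega> * max 0 (ln (Y j \<omega> / (b * v))))) \<partial>M)"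
  proof (rule nn_integral_cong)
    fix \<omega>
    have "(\<Sum>j=1..n. ennreal (?w j \<omega> * max 0 (ln (Y j \<omega> / (b * v)))))
        = ennreal (\<Sum>j=1..n. ?w j \<omega> * max 0 (ln (Y j \<omega> / (b * v))))"
      using K(1) by (intro sum_ennreal) simp
    then show "ennreal (log_excess K h X Y x n (b * v) \<omega>) = ennreal (1 / (real n * h n)) *
        (\<Sum>j=1..n. ennreal (?w j \<omega> * max 0 (ln (Y j \<omega> / (b * v)))))"
      using K(1) pos unfolding log_excess_def
      by (simp only: ennreal_mult'[symmetric] sum_nonneg divide_nonneg_nonneg)
         (subst ennreal_mult'[symmetric], auto intro!: sum_nonneg)
  qed
  also have "\<dots> = ennreal (1 / (real n * h n)) *
        (\<Sum>j=1..n. \<integral>\<^sup>+\<omega>. ennreal (?w j \<omega> * max 0 (ln (Y j \<omega> / (b * v)))) \<partial>M)"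
    by (subst nn_integral_cmult) (auto simp: nn_integral_sum)
  also have "\<dots> \<le> ennreal (1 / (real n * h n)) * (\<Sum>j=1..n. ennreal (A / (1 - q)))"
    by (intro mult_left_mono sum_mono one) auto
  also have "\<dots> = ennreal (1 / (real n * h n) * (real n * (A / (1 - q))))"
    using A q pos by (subst sum_ennreal) (auto simp: ennreal_mult'[symmetric])
  also have "1 / (real n * h n) * (real n * (A / (1 - q))) =
      2 * b\<^sub>K * b\<^sub>g * C * ln 2 / (1 - q) * b powr - \<delta> * p"
    using pos by (simp add: A_def field_simps)
  finally show ?thesis by (simp add: q_def)
qed

section \<open>Consistency of the conditional Hill estimator\<close>

text \<open>A purely deterministic estimate for one sample. The shift by \<open>3\<close> in the lower bound comes from the normalisation of
\<open>\<tau>\<close>, whose argument \<open>0\<close> stands for the grid point \<open>1 / r\<close>: the lower sum starts at \<open>r\<^sup>2\<close>.\<close>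

lemma cond_hill_grid_bounds:
  fixes X Y :: "int \<Rightarrow> 'a \<Rightarrow> real" and K :: "real \<Rightarrow> real" and h k :: "nat \<Rightarrow> real"
    and \<kappa> :: "real \<Rightarrow> real measure" and n :: nat and \<omega> :: 'a and x r :: real
  defines "u \<equiv> threshold \<kappa> k x n"
    and "\<tau> \<equiv> \<lambda>i. tail_T \<kappa> K h k X Y x (r ^ i / r) n \<omega>"
  assumes K: "\<And>v. 0 \<le> K v" and Y: "\<And>j. Y j \<omega> > 0" and n: "n > 0" "h n > 0"
    and sf: "cond_sf \<kappa> x u = k n / real n" and k: "0 < k n" "k n < real n" and u: "u > 0"
    and r: "r > 1" and above: "\<tau> 0 > 1" and below: "\<tau> 2 \<le> 1"
  shows "cond_hill \<kappa> K h k X Y x n \<omega> \<le> ln r * (\<Sum>i<m. \<tau> i)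
      + real n / k n * log_excess K h X Y x n (r ^ m / r * u) \<omega> / kernel_density K h X x n \<omega>"
    and "ln r * (\<Sum>i<m. \<tau> (i + 3)) \<le> cond_hill \<kappa> K h k X Y x n \<omega>"
proof -
  define w where "w j = K ((x - X (int j) \<omega>) / h n)" for j :: nat
  define W where "W = (\<Sum>j=1..n. w j)"
  \<comment> \<open>The weighted empirical functional: \<open>\<tau>\<close> is its value at indicators of half-lines, the Hill
    estimator its value at \<open>\<lambda>y. max 0 (ln (y / q))\<close>.\<close>
  define S where "S f = real n / k n * ((\<Sum>j=1..n. w j * f (Y (int j) \<omega>)) / W)"
    for f :: "real \<Rightarrow> real"
  have w: "w j \<ge> 0" for j using K by (simp add: w_def)
  have T: "tail_T \<kappa> K h k X Y x s n \<omega> = S (indicator {z. z > s * u})" for s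
    using n k sf by (simp add: tail_T_def tail_V_def kernel_density_def S_def w_def W_def u_def)
  \<comment> \<open>With zero total weight every tail value would be \<open>0\<close>, by the convention for division.\<close>
  have "W \<noteq> 0" using above unfolding \<tau>_def T S_def by auto
  moreover have "W \<ge> 0" unfolding W_def by (intro sum_nonneg w)
  ultimately have W: "W > 0" by simp
  have S_mono: "S f \<le> S f'" if "\<And>y. y > 0 \<Longrightarrow> f y \<le> f' y" for f f'
    unfolding S_def using W k Y w that
    by (intro mult_left_mono divide_right_mono sum_mono) auto
  have S_add: "S (\<lambda>y. f y + f' y) = S f + S f'" for f f'
    by (simp add: S_def sum.distrib distrib_left add_divide_distrib)
  have S_scale: "S (\<lambda>y. a * f y) = a * S f" for a f
    by (simp add: S_def mult.left_commute[of _ a] flip: sum_distrib_left)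
  have S_sum: "S (\<lambda>y. \<Sum>i<m. f i y) = (\<Sum>i<m. S (f i))" for f :: "nat \<Rightarrow> real \<Rightarrow> real" and m
  proof (induction m)
    case 0
    show ?case by (simp add: S_def)
  qed (simp add: S_add)
  have S_grid: "S (\<lambda>y. ln r * (\<Sum>i<m. indicator {z. z > r ^ (i + l) / r * u} y))
      = ln r * (\<Sum>i<m. \<tau> (i + l))" for l
    unfolding S_scale S_sum by (simp add: \<tau>_def T)
  define F where "F y = 1 - nw_sf K h X Y x n \<omega> y" for y
  define q where "q = nw_quantile K h k X Y x n \<omega>"
  have F: "1 - k n / real n \<le> F (s * u) \<longleftrightarrow> tail_T \<kappa> K h k X Y x s n \<omega> \<le> 1" for s
    unfolding T using n k W by (simp add: F_def nw_sf_def S_def w_def W_def field_simps)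
  have mono: "mono F" unfolding F_def by (rule mono_nw_cdf[OF K])
  \<comment> \<open>The empirical tail exceeds its target level at \<open>u / r\<close> but not at \<open>r * u\<close>, which traps the
    empirical quantile.\<close>
  have in_S: "1 - k n / real n \<le> F (r * u)"
    unfolding F using below r by (simp add: \<tau>_def power2_eq_square)
  have lb: "1 / r * u \<le> y" if "1 - k n / real n \<le> F y" for y
  proof (rule ccontr)
    assume "\<not> 1 / r * u \<le> y"
    then have "F y \<le> F (1 / r * u)" by (intro monoD[OF mono]) simp
    then have "tail_T \<kappa> K h k X Y x (1 / r) n \<omega> \<le> 1" using that by (simp flip: F)
    then show False using above by (simp add: \<tau>_def)
  qed
  have q_eq: "q = Inf {y. 1 - k n / real n \<le> F y}"
    by (simp add: q_def nw_quantile_def gen_inverse_def F_def)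
  have q_le: "q \<le> r * u"
    unfolding q_eq using in_S lb by (intro cInf_lower bdd_belowI[of _ "1 / r * u"]) auto
  have q_ge: "1 / r * u \<le> q"
    unfolding q_eq using in_S lb by (intro cInf_greatest) auto
  have q_pos: "q > 0" using q_ge u r by (smt (verit) divide_pos_pos mult_pos_pos)
  have hill: "cond_hill \<kappa> K h k X Y x n \<omega> = S (\<lambda>y. max 0 (ln (y / q)))"
    unfolding S_def w_def W_def q_def
    by (rule cond_hill_eq_log) (use sf q_pos Y in \<open>auto simp: u_def q_def\<close>)
  have antitone: "max 0 (ln (y / b)) \<le> max 0 (ln (y / a))" if "0 < a" "a \<le> b" "y > 0" for a b y :: real
    using that by (intro max.mono) (auto simp: divide_left_mono)
  have "cond_hill \<kappa> K h k X Y x n \<omega> \<le>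
      S (\<lambda>y. ln r * (\<Sum>i<m. indicator {z. z > r ^ (i + 0) / r * u} y)
             + max 0 (ln (y / (r ^ m / r * u))))"
    unfolding hill
  proof (rule S_mono)
    fix y :: real assume y: "y > 0"
    have "max 0 (ln (y / q)) \<le> max 0 (ln (y / (1 / r * u)))"
      using q_ge u r y by (intro antitone) auto
    also have "\<dots> \<le> ln r * (\<Sum>i<m. indicator {z. z > r ^ i} (y / (1 / r * u)))
        + max 0 (ln (y / (1 / r * u) / r ^ m))"
      using u r y by (intro log_plus_le_grid) auto
    also have "(\<lambda>i. indicator {z. z > r ^ i} (y / (1 / r * u)) :: real)
        = (\<lambda>i. indicator {z. z > r ^ (i + 0) / r * u} y)"
      using u r by (intro ext) (simp add: indicator_def field_simps)
    also have "y / (1 / r * u) / r ^ m = y / (r ^ m / r * u)" using u r by (simp add: field_simps)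
    finally show "max 0 (ln (y / q)) \<le> ln r * (\<Sum>i<m. indicator {z. z > r ^ (i + 0) / r * u} y)
             + max 0 (ln (y / (r ^ m / r * u)))" .
  qed
  also have "\<dots> = ln r * (\<Sum>i<m. \<tau> i) + S (\<lambda>y. max 0 (ln (y / (r ^ m / r * u))))"
    unfolding S_add S_grid by simp
  also have "S (\<lambda>y. max 0 (ln (y / (r ^ m / r * u)))) =
      real n / k n * log_excess K h X Y x n (r ^ m / r * u) \<omega> / kernel_density K h X x n \<omega>"
    using n by (simp add: S_def log_excess_def kernel_density_def w_def W_def)
  finally show "cond_hill \<kappa> K h k X Y x n \<omega> \<le> ln r * (\<Sum>i<m. \<tau> i) + \<dots>" .
  have "S (\<lambda>y. ln r * (\<Sum>i<m. indicator {z. z > r ^ (i + 3) / r * u} y)) \<le> cond_hill \<kappa> K h k X Y x n \<omega>"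
    unfolding hill
  proof (rule S_mono)
    fix y :: real assume y: "y > 0"
    have "(\<Sum>i<m. indicator {z. z > r ^ (i + 3) / r * u} y :: real)
        = (\<Sum>i<m. indicator {z. z > r ^ Suc i} (y / (r * u)))"
      using u r by (intro sum.cong) (simp_all add: indicator_def field_simps power3_eq_cube power_add)
    moreover have "ln r * (\<Sum>i<m. indicator {z. z > r ^ Suc i} (y / (r * u))) \<le> max 0 (ln (y / (r * u)))"
      using u r y by (intro grid_le_log_plus) auto
    ultimately have "ln r * (\<Sum>i<m. indicator {z. z > r ^ (i + 3) / r * u} y) \<le> max 0 (ln (y / (r * u)))"
      by (simp only:)
    also have "\<dots> \<le> max 0 (ln (y / q))" using q_le q_pos y by (intro antitone) auto
    finally show "ln r * (\<Sum>i<m. indicator {z. z > r ^ (i + 3) / r * u} y) \<le> max 0 (ln (y / q))" .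
  qed
  then show "ln r * (\<Sum>i<m. \<tau> (i + 3)) \<le> cond_hill \<kappa> K h k X Y x n \<omega>"
    unfolding S_grid .
qed

theorem theorem3:
  fixes M :: "'a measure"
    and X Y :: "int \<Rightarrow> 'a \<Rightarrow> real"
    and g K :: "real \<Rightarrow> real"
    and \<kappa> :: "real \<Rightarrow> real measure"
    and U :: "real set" and x :: real
    and \<gamma> :: "real \<Rightarrow> real" and L :: "real \<Rightarrow> real \<Rightarrow> real"
    and h k :: "nat \<Rightarrow> real"
    and c\<^sub>\<gamma> :: real
  assumes prob: "prob_space M"
    and stat: "stationary M (\<lambda>j \<omega>. (X j \<omega>, Y j \<omega>))"
    and Y_pos: "\<And>j \<omega>. \<omega> \<in> space M \<Longrightarrow> Y j \<omega> > 0"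
    and g_nonneg: "\<And>u. g u \<ge> 0"
    and g_density: "distributed M lborel (X 0) (\<lambda>u. ennreal (g u))"
    and g_C2: "C2_on_reals g"
    and joint_density: "\<And>i j. i \<noteq> j \<Longrightarrow>
          \<exists>(f :: real \<times> real \<Rightarrow> real) C. (\<forall>z. 0 \<le> f z \<and> f z \<le> C) \<and>
            distributed M lborel (\<lambda>\<omega>. (X i \<omega>, X j \<omega>)) (\<lambda>z. ennreal (f z))"
    and cond_dist: "regular_cond_dist M (X 0) (Y 0) \<kappa>"
    and U: "open U" "x \<in> U"
    and gx_pos: "g x > 0"
    and gamma_pos: "\<And>u. u \<in> U \<Longrightarrow> \<gamma> u > 0"
    and L_sv: "\<And>u. u \<in> U \<Longrightarrow> slowly_varying (L u)"
    and reg_var: "\<And>u y. u \<in> U \<Longrightarrow> y > 0 \<Longrightarrow> cond_sf \<kappa> u y = L u y * y powr (- 1 / \<gamma> u)"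
    and K_meas: "K \<in> borel_measurable borel"
    and K_nonneg: "\<And>v. K v \<ge> 0"
    and K_bounded: "bounded (range K)"
    and K_supp: "\<And>v. v \<notin> {-1..1} \<Longrightarrow> K v = 0"
    and K_density: "prob_space (density lborel (\<lambda>v. ennreal (K v)))"
    and h_pos: "\<And>n. h n > 0"
    and k_le: "\<And>n. k n \<le> real n"
    and k_lim: "filterlim k at_top sequentially"
    and k_div: "(\<lambda>n. k n / real n) \<longlonglongrightarrow> 0"
    and threshold_eq: "\<forall>\<^sub>F n in sequentially. cond_sf \<kappa> x (threshold \<kappa> k x n) = k n / real n"
    and C1: "c\<^sub>\<gamma>-lipschitz_on U (\<lambda>u. 1 / \<gamma> u)"
    and C2: "(\<lambda>n. h n * ln (threshold \<kappa> k x n)) \<longlonglongrightarrow> 0"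
    and C3: "\<exists>y\<^sub>0>1. \<exists>c\<^sub>L>0. \<forall>u\<in>U. \<forall>v\<in>U. \<forall>y\<ge>y\<^sub>0.
          \<bar>(ln (L v y) - ln (L u y)) / ln y\<bar> \<le> c\<^sub>L * \<bar>v - u\<bar>"
    and C5: "conv_in_prob M (kernel_density K h X x) (g x)"
    and T_conv: "\<And>s. s > 0 \<Longrightarrow>
          conv_in_prob M (tail_T \<kappa> K h k X Y x s) (s powr (- 1 / \<gamma> x))"
  shows "conv_in_prob M (cond_hill \<kappa> K h k X Y x) (\<gamma> x)"
proof -
  interpret prob_space M by fact
  have g_cont: "continuous_on UNIV g"
    using g_C2 unfolding C2_on_reals_def
    by (meson DERIV_isCont continuous_at_imp_continuous_on)
  have XY [measurable]: "X j \<in> borel_measurable M" "Y j \<in> borel_measurable M" for j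
  proof -
    have "(\<lambda>\<omega>. (X j \<omega>, Y j \<omega>)) \<in> measurable M (borel \<Otimes>\<^sub>M borel)"
      using stat unfolding borel_prod by (auto simp: stationary_def)
    from measurable_compose[OF this measurable_fst] measurable_compose[OF this measurable_snd]
    show "X j \<in> borel_measurable M" "Y j \<in> borel_measurable M" by simp_all
  qed
  note [measurable] = K_meas
  note kappa = regular_cond_dist_prob_space[OF cond_dist]
  have sf_anti: "antimono (cond_sf \<kappa> u)" and sf_nonneg: "cond_sf \<kappa> u y \<ge> 0" for u y
  proof -
    interpret \<kappa>: prob_space "\<kappa> u" by (rule kappa)
    show "antimono (cond_sf \<kappa> u)"
      unfolding cond_sf_def cdf_def
      by (intro antimonoI diff_left_mono \<kappa>.finite_measure_mono) (auto simp: kappa)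
    show "cond_sf \<kappa> u y \<ge> 0" by (simp add: cond_sf_def cdf_def)
  qed
  define \<alpha> where "\<alpha> = 1 / \<gamma> x"
  have \<alpha>: "\<alpha> > 0" "\<gamma> x = 1 / \<alpha>" using gamma_pos[OF U(2)] by (auto simp: \<alpha>_def)
  define u where "u = threshold \<kappa> k x"
  define p where "p n = k n / real n" for n
  have sf_u: "\<forall>\<^sub>F n in sequentially. cond_sf \<kappa> x (u n) = p n"
    using threshold_eq by (simp add: u_def p_def)
  have sf_pos: "cond_sf \<kappa> x y > 0" for y
    using regularly_varying_tail_pos[OF sf_anti L_sv[OF U(2)] reg_var[OF U(2)]] .
  have u_lim: "filterlim u at_top sequentially"
    unfolding filterlim_at_top
  proof
    fix Z
    have "\<forall>\<^sub>F n in sequentially. p n < cond_sf \<kappa> x Z"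
      using order_tendstoD(2)[OF k_div sf_pos[of Z]] by (simp add: p_def)
    with sf_u show "\<forall>\<^sub>F n in sequentially. Z \<le> u n"
    proof eventually_elim
      case (elim n)
      then show ?case using antimonoD[OF sf_anti, of "u n" Z x] by (cases "Z \<le> u n") auto
    qed
  qed
  \<comment> \<open>The bandwidth vanishes because \<open>h n * ln (u n)\<close> does while \<open>u n\<close> diverges.\<close>
  have h_lim: "h \<longlonglongrightarrow> 0"
  proof (rule tendsto_sandwich[OF _ _ tendsto_const C2])
    have "\<forall>\<^sub>F n in sequentially. exp 1 \<le> u n" using u_lim unfolding filterlim_at_top by blast
    then show "\<forall>\<^sub>F n in sequentially. h n \<le> h n * ln (threshold \<kappa> k x n)"
    proof eventually_elim
      case (elim n)
      then have "1 \<le> ln (u n)" by (subst ln_ge_iff) (auto intro: less_le_trans[OF exp_gt_zero])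
      then show ?case using h_pos[of n] mult_left_mono[of 1 "ln (u n)" "h n"] by (simp add: u_def)
    qed
  qed (use h_pos in \<open>auto intro!: always_eventually less_imp_le\<close>)
  obtain y\<^sub>0 c\<^sub>L where C3': "y\<^sub>0 > 1" "c\<^sub>L > 0" "\<And>u v y. u \<in> U \<Longrightarrow> v \<in> U \<Longrightarrow> y \<ge> y\<^sub>0 \<Longrightarrow>
          \<bar>(ln (L v y) - ln (L u y)) / ln y\<bar> \<le> c\<^sub>L * \<bar>v - u\<bar>"
    using C3 by blast
  obtain C \<delta> where C: "C > 0" "\<delta> > 0" "\<forall>\<^sub>F n in sequentially. \<forall>s\<ge>1. \<forall>v. \<bar>v - x\<bar> \<le> h n \<longrightarrow>
       cond_sf \<kappa> v (s * u n) \<le> C * s powr - \<delta> * cond_sf \<kappa> x (u n)"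
    using tail_ratio_power_bound[OF U(2,1) gamma_pos[OF U(2)] sf_anti sf_nonneg L_sv reg_var C1 C3'
        h_pos h_lim u_lim] C2 by (auto simp: u_def)
  obtain b\<^sub>K where "\<And>v. \<bar>K v\<bar> \<le> b\<^sub>K"
    using K_bounded by (auto simp: bounded_iff)
  then have b\<^sub>K: "K v \<le> b\<^sub>K" for v by (meson abs_le_D1)
  have "bounded (g ` {x - 1..x + 1})"
    by (intro compact_imp_bounded compact_continuous_image continuous_on_subset[OF g_cont]) auto
  then obtain b\<^sub>g where "\<And>v. v \<in> {x - 1..x + 1} \<Longrightarrow> \<bar>g v\<bar> \<le> b\<^sub>g"
    unfolding bounded_iff by (metis imageI real_norm_def)
  then have b\<^sub>g: "g v \<le> b\<^sub>g" if "\<bar>v - x\<bar> \<le> 1" for v using that by (force simp: abs_le_iff)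
  define Q where "Q = 2 * b\<^sub>K * b\<^sub>g * C * ln 2 / (1 - 2 powr - \<delta>)"
  have Q: "Q \<ge> 0"
  proof -
    have "b\<^sub>K \<ge> 0" "b\<^sub>g \<ge> 0" using order_trans[OF K_nonneg b\<^sub>K] order_trans[OF g_nonneg b\<^sub>g[of x]] by auto
    moreover have "2 powr - \<delta> < 1" using C by (simp add: powr_minus_divide)
    ultimately show ?thesis using C by (simp add: Q_def)
  qed
  have log_excess_meas [measurable]: "log_excess K h X Y x n v \<in> borel_measurable M" for n v
  proof -
    have "(\<lambda>\<omega>. log_excess K h X Y x n v \<omega>) \<in> borel_measurable M"
      unfolding log_excess_def by measurable
    then show ?thesis by simp
  qed
  have good: "\<forall>\<^sub>F n in sequentially. n > 0 \<and> 0 < k n \<and> k n < real n \<and> u n > 0 \<and>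
      cond_sf \<kappa> x (u n) = p n"
  proof -
    have "\<forall>\<^sub>F n in sequentially. p n < 1"
      using order_tendstoD(2)[OF k_div, of 1] by (simp add: p_def)
    moreover have "\<forall>\<^sub>F n in sequentially. k n > 0" "\<forall>\<^sub>F n in sequentially. u n > 0"
      using k_lim u_lim by (auto simp: filterlim_at_top_dense)
    ultimately show ?thesis
      using sf_u eventually_gt_at_top[of 0]
      by eventually_elim (simp add: p_def)
  qed
  \<comment> \<open>By Markov. The right-hand side is free of \<open>n\<close>, so that \<open>b\<close> can be chosen before \<open>n\<close>.\<close>
  have tail: "\<forall>\<^sub>F n in sequentially.
      prob {\<omega> \<in> space M. c \<le> log_excess K h X Y x n (b * u n) \<omega> / p n} \<le> Q * b powr - \<delta> / c"
    if "c > 0" "b \<ge> 1" for b c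
  proof -
    have "\<forall>\<^sub>F n in sequentially. h n < 1" using order_tendstoD(2)[OF h_lim, of 1] by simp
    with C(3) good show ?thesis
    proof eventually_elim
      case (elim n)
      have p: "p n > 0" using elim by (simp add: p_def)
      have "(\<integral>\<^sup>+\<omega>. ennreal (log_excess K h X Y x n (b * u n) \<omega>) \<partial>M) \<le> ennreal (Q * b powr - \<delta> * p n)"
        unfolding Q_def
      proof (rule expected_log_excess_le[OF XY Y_pos stat g_density cond_dist K_meas K_nonneg b\<^sub>K K_supp])
        show "cond_sf \<kappa> w (s * u n) \<le> C * s powr - \<delta> * p n" if "\<bar>w - x\<bar> \<le> h n" "s \<ge> 1" for w s
          using elim that by auto
      qed (use elim C p h_pos that g_nonneg b\<^sub>g in auto)
      then have *: "(\<integral>\<^sup>+\<omega>. ennreal (log_excess K h X Y x n (b * u n) \<omega>) \<partial>M) \<le> ennreal (Q * b powr - \<delta> * p n)" .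
      have nn: "log_excess K h X Y x n (b * u n) \<omega> \<ge> 0" for \<omega>
        unfolding log_excess_def using h_pos[of n] K_nonneg
        by (intro mult_nonneg_nonneg sum_nonneg) (auto intro: less_imp_le)
      have "emeasure M ({\<omega> \<in> space M. 1 \<le> ennreal (1 / (c * p n)) * ennreal (log_excess K h X Y x n (b * u n) \<omega>)})
          \<le> ennreal (1 / (c * p n)) * (\<integral>\<^sup>+\<omega>. ennreal (log_excess K h X Y x n (b * u n) \<omega>) * indicator (space M) \<omega> \<partial>M)"
        by (rule nn_integral_Markov_inequality) auto
      also have "(\<integral>\<^sup>+\<omega>. ennreal (log_excess K h X Y x n (b * u n) \<omega>) * indicator (space M) \<omega> \<partial>M)
          = (\<integral>\<^sup>+\<omega>. ennreal (log_excess K h X Y x n (b * u n) \<omega>) \<partial>M)"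
        by (rule nn_integral_cong) simp
      also have "ennreal (1 / (c * p n)) * \<dots> \<le> ennreal (1 / (c * p n)) * ennreal (Q * b powr - \<delta> * p n)"
        by (intro mult_left_mono *) auto
      also have "\<dots> = ennreal (Q * b powr - \<delta> / c)"
        using p that by (simp add: ennreal_mult'[symmetric])
      also have "{\<omega> \<in> space M. 1 \<le> ennreal (1 / (c * p n)) * ennreal (log_excess K h X Y x n (b * u n) \<omega>)}
          = {\<omega> \<in> space M. c \<le> log_excess K h X Y x n (b * u n) \<omega> / p n}"
        using p that nn by (auto simp: ennreal_mult'[symmetric] field_simps)
      finally show ?case using Q that by (simp add: emeasure_eq_measure)
    qed
  qed
  have limit: "\<forall>\<^sub>F n in sequentially. prob {\<omega> \<in> space M. \<bar>cond_hill \<kappa> K h k X Y x n \<omega> - \<gamma> x\<bar> > \<epsilon>} < \<eta>"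
    if eps: "\<epsilon> > 0" "\<eta> > 0" for \<epsilon> \<eta>
  proof -
    obtain r \<rho> :: real where r: "r > 1" "\<rho> = r powr - \<alpha>" "0 < \<rho>" "\<rho> < 1"
      "ln r / (\<rho> * (1 - \<rho>)) < 1 / \<alpha> + \<epsilon> / 4" "ln r * (\<rho>\<^sup>2 / (1 - \<rho>)) > 1 / \<alpha> - \<epsilon> / 4"
      using exists_grid_ratio[OF \<alpha>(1), of "\<epsilon> / 4"] eps by auto
    have grid: "(r ^ i / r) powr - \<alpha> = \<rho> ^ i / \<rho>" for i
      using r(1) by (simp add: powr_divide r(2) powr_powr powr_realpow[symmetric] mult.commute)
    \<comment> \<open>The constants are chosen in the order \<open>r\<close> (error of the infinite grid sums), \<open>c\<close> (so that
      \<open>c\<close> divided by \<open>g x / 2\<close> is \<open>\<epsilon> / 4\<close>), \<open>m\<close> (truncation of the sums, probability of a large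
      tail share), \<open>e\<close> (error of finitely many empirical tails).\<close>
    define c where "c = \<epsilon> * g x / 8"
    have c: "c > 0" using eps gx_pos by (simp add: c_def)
    define B where "B = ln r * (\<rho>\<^sup>2 / (1 - \<rho>))"
    have "(\<lambda>m. B * \<rho> ^ m) \<longlonglongrightarrow> B * 0"
      using r by (intro tendsto_mult tendsto_const LIMSEQ_realpow_zero) auto
    then have "\<forall>\<^sub>F m in sequentially. B * \<rho> ^ m < \<epsilon> / 4"
      using eps by (intro order_tendstoD) auto
    moreover have "(\<lambda>m. Q * ((r powr - \<delta>) ^ m / r powr - \<delta>) / c) \<longlonglongrightarrow> Q * (0 / r powr - \<delta>) / c"
      using r(1) C c by (intro tendsto_intros LIMSEQ_realpow_zero) (auto simp: powr_less_one)
    then have "\<forall>\<^sub>F m in sequentially. Q * ((r powr - \<delta>) ^ m / r powr - \<delta>) / c < \<eta> / 2"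
      using eps by (intro order_tendstoD) auto
    ultimately have "\<forall>\<^sub>F m in sequentially. B * \<rho> ^ m < \<epsilon> / 4 \<and>
        Q * ((r powr - \<delta>) ^ m / r powr - \<delta>) / c < \<eta> / 2 \<and> m > 0"
      using eventually_gt_at_top[of 0] by eventually_elim auto
    then obtain m where m: "B * \<rho> ^ m < \<epsilon> / 4"
        "Q * ((r powr - \<delta>) ^ m / r powr - \<delta>) / c < \<eta> / 2" "m > 0"
      by (auto simp: eventually_sequentially)
    \<comment> \<open>The cutoff at which the upper sum stops; \<open>m > 0\<close> ensures \<open>b \<ge> 1\<close>, where the mean bound applies.\<close>
    define b where "b = r ^ m / r"
    have b: "b \<ge> 1" using r(1) m(3) self_le_power[of r m] by (simp add: b_def)
    have b_powr: "b powr - \<delta> = (r powr - \<delta>) ^ m / r powr - \<delta>"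
      using r(1) by (simp add: b_def powr_divide powr_powr powr_realpow[symmetric] mult.commute)
    define e where "e = min (1 - \<rho>) (\<epsilon> / (4 * ln r * real m))"
    have e: "e > 0" "e \<le> 1 - \<rho>" "ln r * (real m * e) \<le> \<epsilon> / 4"
    proof -
      have pos: "4 * ln r * real m > 0" using r(1) m(3) by simp
      show "e > 0" "e \<le> 1 - \<rho>" using r eps pos by (simp_all add: e_def)
      have "e * (4 * ln r * real m) \<le> \<epsilon>"
        using pos by (simp add: pos_le_divide_eq[symmetric] e_def)
      then show "ln r * (real m * e) \<le> \<epsilon> / 4" by (simp add: mult_ac)
    qed
    define \<tau> where "\<tau> i = tail_T \<kappa> K h k X Y x (r ^ i / r)" for i
    \<comment> \<open>Outside these three events the deterministic bounds force the estimator to within \<open>\<epsilon>\<close>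
      of \<open>\<gamma> x\<close>.\<close>
    define E\<^sub>1 where "E\<^sub>1 n = {\<omega> \<in> space M. \<exists>i\<in>{..m + 3}. \<bar>\<tau> i n \<omega> - \<rho> ^ i / \<rho>\<bar> > e}" for n
    define E\<^sub>2 where "E\<^sub>2 n = {\<omega> \<in> space M. \<bar>kernel_density K h X x n \<omega> - g x\<bar> > g x / 2}" for n
    define E\<^sub>3 where "E\<^sub>3 n = {\<omega> \<in> space M. c \<le> log_excess K h X Y x n (b * u n) \<omega> / p n}" for n
    have tau_conv: "conv_in_prob M (\<tau> i) (\<rho> ^ i / \<rho>)" for i
      using T_conv[of "r ^ i / r"] r(1) grid[of i] by (simp add: \<tau>_def \<alpha>_def)
    have tau_meas [measurable]: "\<tau> i n \<in> borel_measurable M" for i n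
      using tau_conv[of i] by (simp add: conv_in_prob_def)
    have density_meas [measurable]: "kernel_density K h X x n \<in> borel_measurable M" for n
      using C5 by (simp add: conv_in_prob_def)
    have E_sets: "E\<^sub>1 n \<in> sets M" "E\<^sub>2 n \<in> sets M" "E\<^sub>3 n \<in> sets M" for n
      unfolding E\<^sub>1_def E\<^sub>2_def E\<^sub>3_def by measurable
    have "(\<lambda>n. prob (E\<^sub>1 n)) \<longlonglongrightarrow> 0"
      unfolding E\<^sub>1_def
      by (rule conv_in_prob_finite_family[OF _ finite_measure_axioms tau_conv e(1)]) auto
    then have "\<forall>\<^sub>F n in sequentially. prob (E\<^sub>1 n) < \<eta> / 4" using eps by (intro order_tendstoD) auto
    moreover have "(\<lambda>n. prob (E\<^sub>2 n)) \<longlonglongrightarrow> 0"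
      using C5 half_gt_zero[OF gx_pos] unfolding conv_in_prob_def E\<^sub>2_def by blast
    then have "\<forall>\<^sub>F n in sequentially. prob (E\<^sub>2 n) < \<eta> / 4" using eps by (intro order_tendstoD) auto
    moreover have "\<forall>\<^sub>F n in sequentially. prob (E\<^sub>3 n) < \<eta> / 2"
      using tail[OF c b] unfolding E\<^sub>3_def
    proof eventually_elim
      case (elim n)
      then show ?case using m(2) unfolding b_powr by linarith
    qed
    ultimately show ?thesis using good
    proof eventually_elim
      case (elim n)
      have "{\<omega> \<in> space M. \<bar>cond_hill \<kappa> K h k X Y x n \<omega> - \<gamma> x\<bar> > \<epsilon>} \<subseteq> E\<^sub>1 n \<union> (E\<^sub>2 n \<union> E\<^sub>3 n)"
      proof (rule subsetI, rule ccontr)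
        fix \<omega> assume \<omega>: "\<omega> \<in> {\<omega> \<in> space M. \<bar>cond_hill \<kappa> K h k X Y x n \<omega> - \<gamma> x\<bar> > \<epsilon>}"
          and "\<omega> \<notin> E\<^sub>1 n \<union> (E\<^sub>2 n \<union> E\<^sub>3 n)"
        then have \<tau>: "\<And>i. i \<le> m + 3 \<Longrightarrow> \<bar>\<tau> i n \<omega> - \<rho> ^ i / \<rho>\<bar> \<le> e"
          and D: "\<bar>kernel_density K h X x n \<omega> - g x\<bar> \<le> g x / 2"
          and A: "log_excess K h X Y x n (b * u n) \<omega> / p n < c"
          by (auto simp: E\<^sub>1_def E\<^sub>2_def E\<^sub>3_def not_less not_le)
        \<comment> \<open>Since \<open>e \<le> 1 - \<rho> < 1 / \<rho> - 1\<close>, the tail values at \<open>1 / r\<close> and \<open>r\<close> lie on either side of \<open>1\<close>.\<close>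
        have "1 / \<rho> - 1 = (1 - \<rho>) / \<rho>" using r(3,4) by (simp add: field_simps)
        also have "\<dots> > 1 - \<rho>" using r(3,4) by (simp add: pos_less_divide_eq)
        finally have \<tau>0: "\<tau> 0 n \<omega> > 1" using \<tau>[of 0] e(2) by (simp add: abs_le_iff)
        have \<tau>2: "\<tau> 2 n \<omega> \<le> 1" using \<tau>[of 2] e(2) r(3,4) by (simp add: abs_le_iff power2_eq_square)
        have bounds: "cond_hill \<kappa> K h k X Y x n \<omega> \<le> ln r * (\<Sum>i<m. \<tau> i n \<omega>)
              + real n / k n * log_excess K h X Y x n (b * u n) \<omega> / kernel_density K h X x n \<omega>"
            "ln r * (\<Sum>i<m. \<tau> (i + 3) n \<omega>) \<le> cond_hill \<kappa> K h k X Y x n \<omega>"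
          unfolding \<tau>_def b_def u_def
          by (rule cond_hill_grid_bounds; use \<omega> elim K_nonneg Y_pos h_pos r(1) \<tau>0 \<tau>2 in
              \<open>simp add: \<tau>_def u_def p_def\<close>)+
        have lnr: "ln r > 0" using r(1) by simp
        have geo: "(\<Sum>i<m. \<rho> ^ i) = (1 - \<rho> ^ m) / (1 - \<rho>)" using r(3,4) by (simp add: sum_gp_strict)
        have "(\<Sum>i<m. \<tau> i n \<omega>) \<le> (\<Sum>i<m. \<rho> ^ i / \<rho> + e)"
        proof (rule sum_mono)
          fix i assume "i \<in> {..<m}"
          then show "\<tau> i n \<omega> \<le> \<rho> ^ i / \<rho> + e" using \<tau>[of i] by (simp add: abs_le_iff)
        qed
        also have "\<dots> = (1 - \<rho> ^ m) / (1 - \<rho>) / \<rho> + real m * e"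
          by (simp add: sum.distrib geo flip: sum_divide_distrib)
        also have "(1 - \<rho> ^ m) / (1 - \<rho>) / \<rho> \<le> 1 / (\<rho> * (1 - \<rho>))"
          using r(3,4) by (simp add: field_simps)
        finally have "ln r * (\<Sum>i<m. \<tau> i n \<omega>) \<le> ln r * (1 / (\<rho> * (1 - \<rho>)) + real m * e)"
          using lnr by (intro mult_left_mono) auto
        also have "\<dots> = ln r / (\<rho> * (1 - \<rho>)) + ln r * (real m * e)" by (simp add: distrib_left)
        also have "\<dots> < \<gamma> x + \<epsilon> / 2" using r(5) e(3) \<alpha>(2) by simp
        finally have up: "ln r * (\<Sum>i<m. \<tau> i n \<omega>) < \<gamma> x + \<epsilon> / 2" .
        have D': "kernel_density K h X x n \<omega> \<ge> g x / 2" using D by arith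
        have "real n / k n * log_excess K h X Y x n (b * u n) \<omega> \<le> c"
          using A by (simp add: p_def mult.commute)
        then have "real n / k n * log_excess K h X Y x n (b * u n) \<omega> / kernel_density K h X x n \<omega>
            \<le> c / (g x / 2)"
          using D' gx_pos c by (intro order_trans[OF divide_right_mono divide_left_mono]) auto
        also have "\<dots> = \<epsilon> / 4" using gx_pos by (simp add: c_def)
        finally have upper: "cond_hill \<kappa> K h k X Y x n \<omega> \<le> \<gamma> x + \<epsilon>" using bounds(1) up eps by linarith
        have "\<rho>\<^sup>2 * ((1 - \<rho> ^ m) / (1 - \<rho>)) - real m * e = (\<Sum>i<m. \<rho> ^ (i + 3) / \<rho> - e)"
          using r(3,4) by (simp add: sum_subtractf geo[symmetric] sum_distrib_left power_add power2_eq_square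
              power3_eq_cube mult_ac)
        also have "\<dots> \<le> (\<Sum>i<m. \<tau> (i + 3) n \<omega>)"
        proof (rule sum_mono)
          fix i assume "i \<in> {..<m}"
          then show "\<rho> ^ (i + 3) / \<rho> - e \<le> \<tau> (i + 3) n \<omega>" using \<tau>[of "i + 3"] by (simp add: abs_le_iff)
        qed
        finally have "ln r * (\<rho>\<^sup>2 * ((1 - \<rho> ^ m) / (1 - \<rho>)) - real m * e) \<le> ln r * (\<Sum>i<m. \<tau> (i + 3) n \<omega>)"
          using lnr by (intro mult_left_mono) auto
        moreover have "ln r * (\<rho>\<^sup>2 * ((1 - \<rho> ^ m) / (1 - \<rho>)) - real m * e)
            = B - B * \<rho> ^ m - ln r * (real m * e)"
          by (simp add: B_def algebra_simps diff_divide_distrib)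
        ultimately have "\<gamma> x - \<epsilon> \<le> cond_hill \<kappa> K h k X Y x n \<omega>"
          using bounds(2) r(6) m(1) e(3) eps \<alpha>(2) by (simp add: B_def)
        with upper \<omega> show False by (simp add: abs_le_iff not_le[symmetric])
      qed
      then have "prob {\<omega> \<in> space M. \<bar>cond_hill \<kappa> K h k X Y x n \<omega> - \<gamma> x\<bar> > \<epsilon>}
          \<le> prob (E\<^sub>1 n \<union> (E\<^sub>2 n \<union> E\<^sub>3 n))"
        using E_sets by (intro finite_measure_mono) auto
      also have "\<dots> \<le> prob (E\<^sub>1 n) + (prob (E\<^sub>2 n) + prob (E\<^sub>3 n))"
        using E_sets by (intro order_trans[OF measure_Un_le] add_left_mono measure_Un_le) auto
      also have "\<dots> < \<eta>" using elim by linarith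
      finally show ?case .
    qed
  qed
  show ?thesis
    unfolding conv_in_prob_def
  proof (intro conjI allI impI)
    show "cond_hill \<kappa> K h k X Y x n \<in> borel_measurable M" for n
      by (rule borel_measurable_cond_hill[OF XY K_meas K_nonneg])
    show "(\<lambda>n. prob {\<omega> \<in> space M. \<bar>cond_hill \<kappa> K h k X Y x n \<omega> - \<gamma> x\<bar> > \<epsilon>}) \<longlonglongrightarrow> 0"
      if "\<epsilon> > 0" for \<epsilon>
    proof (rule order_tendstoI)
      fix a :: real assume "a < 0"
      then show "\<forall>\<^sub>F n in sequentially. a < prob {\<omega> \<in> space M. \<bar>cond_hill \<kappa> K h k X Y x n \<omega> - \<gamma> x\<bar> > \<epsilon>}"
        by (intro always_eventually allI less_le_trans[OF _ measure_nonneg])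
    qed (rule limit[OF that])
  qed
qed

end
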